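(* For all $(J,E)\in D$ one has $\Delta(J,E)>0$, where $$\Delta(J,E)=\det\begin{pmatrix}\frac{\partial T}{\partial E}&\frac{\partial\Phi}{\partial E}\\[1mm]\frac{\partial T}{\partial J}&\frac{\partial\Phi}{\partial J}\end{pmatrix}(J,E)=\det\begin{pmatrix}\frac{\partial T}{\partial E}&\frac{\partial\Psi}{\partial E}\\[1mm]\frac{\partial T}{\partial J}&\frac{\partial\Psi}{\partial J}\end{pmatrix}(J,E);$$ here the first determinant is used (is meaningful) if $(J,E)\notin\Gamma_+$ and the second one if $(J,E)\notin\Gamma_-$.
   Context: The setting is the solutions of $W_{xx}-W+|W|^2W=0$ ($W:\mathbb{R}\to\mathbb{C}$), with conserved quantities $J=\mathrm{Im}(\overline{W}W_x)$ and $E=\frac12|W_x|^2-\frac12|W|^2+\frac14|W|^4$. For $J\in\mathbb{R}$ write $J=q(1+q^2)$ with $q\in\mathbb{R}$, and set $E_-(J)=\frac14(q^2+1)(3q^2-1)$. Let $D=\{(J,E)\in\mathbb{R}^2\mid E>E_-(J)\}\setminus\{(0,0)\}$. For $(J,E)\in D$ let $y_3\le0\le y_1<y_2$ be the roots of $P(y)=-y^3+2y^2+4Ey-2J^2$ and $s(\varphi)=y_1\cos^2\varphi+y_2\sin^2\varphi$. Let $\Gamma_+=\{(0,E)\mid E>0\}$ (where $y_1=0$) and $\Gamma_-=\{(0,E)\mid -1/4<E<0\}$ (where $y_3=0$). The period of $|W|$ and the phase increment of $W$ over this period are $$T(J,E)=2\sqrt2\int_0^{\pi/2}\frac{d\varphi}{\sqrt{s(\varphi)-y_3}},\qquad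 \Phi(J,E)=2\sqrt2\int_0^{\pi/2}\frac{J}{s(\varphi)}\frac{d\varphi}{\sqrt{s(\varphi)-y_3}},$$ the latter defined (and continuous) on $D\setminus\Gamma_+$. The renormalized phase is defined (and continuous) on $D\setminus\Gamma_-$ by $$\Psi(J,E)=-2\sqrt2\,J\int_0^{\pi/2}\frac{d\varphi}{\sqrt{-y_3}\,\sqrt{s(\varphi)-y_3}\,(\sqrt{-y_3}+\sqrt{s(\varphi)-y_3})},$$ so that $\Psi=\Phi-\pi\,\mathrm{sign}(J)$ when $J\ne0$ and $\Psi=0$ on $\Gamma_+$. *)

theory Defs
  imports "HOL-Analysis.Analysis"
begin

definition E_minus :: "real \<Rightarrow> real" where
  "E_minus J = (let q = (THE q. J = q * (1 + q\<^sup>2)) in (q\<^sup>2 + 1) * (3 * q\<^sup>2 - 1) / 4)"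

definition Dom :: "(real \<times> real) set" where
  "Dom = {(J, E). E > E_minus J} - {(0, 0)}"

definition Gamma_plus :: "(real \<times> real) set" where
  "Gamma_plus = {(0, E) |E. E > 0}"

definition Gamma_minus :: "(real \<times> real) set" where
  "Gamma_minus = {(0, E) |E. - 1 / 4 < E \<and> E < 0}"

definition P :: "real \<Rightarrow> real \<Rightarrow> real \<Rightarrow> real" where
  "P J E y = - (y ^ 3) + 2 * y\<^sup>2 + 4 * E * y - 2 * J\<^sup>2"

text \<open>On \<open>Dom\<close> the three roots are pairwise distinct (the point \<open>(0, 0)\<close>, where
  \<open>y\<^sub>3 = y\<^sub>1 = 0\<close>, is excluded), so the set of roots determines them.\<close>

definition ordered_roots :: "real \<Rightarrow> real \<Rightarrow> real \<Rightarrow> real \<Rightarrow> real \<Rightarrow> bool" where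
  "ordered_roots J E a b c \<longleftrightarrow>
     {y. P J E y = 0} = {a, b, c} \<and> c \<le> 0 \<and> 0 \<le> a \<and> a < b"

definition y1 :: "real \<Rightarrow> real \<Rightarrow> real" where
  "y1 J E = (THE a. \<exists>b c. ordered_roots J E a b c)"

definition y2 :: "real \<Rightarrow> real \<Rightarrow> real" where
  "y2 J E = (THE b. \<exists>a c. ordered_roots J E a b c)"

definition y3 :: "real \<Rightarrow> real \<Rightarrow> real" where
  "y3 J E = (THE c. \<exists>a b. ordered_roots J E a b c)"

definition s :: "real \<Rightarrow> real \<Rightarrow> real \<Rightarrow> real" where
  "s J E \<phi> = y1 J E * (cos \<phi>)\<^sup>2 + y2 J E * (sin \<phi>)\<^sup>2"

definition T :: "real \<Rightarrow> real \<Rightarrow> real" where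
  "T J E = 2 * sqrt 2 * integral {0..pi / 2} (\<lambda>\<phi>. 1 / sqrt (s J E \<phi> - y3 J E))"

text \<open>Only meaningful on \<open>Dom - Gamma_plus\<close>: there \<open>y\<^sub>1 > 0\<close>, so the integrand is continuous.\<close>

definition Phi :: "real \<Rightarrow> real \<Rightarrow> real" where
  "Phi J E = 2 * sqrt 2 *
     integral {0..pi / 2} (\<lambda>\<phi>. J / s J E \<phi> * (1 / sqrt (s J E \<phi> - y3 J E)))"

text \<open>Only meaningful on \<open>Dom - Gamma_minus\<close>: there \<open>y\<^sub>3 < 0\<close>, so the integrand is continuous.\<close>

definition Psi :: "real \<Rightarrow> real \<Rightarrow> real" where
  "Psi J E = - 2 * sqrt 2 * J *
     integral {0..pi / 2} (\<lambda>\<phi>. 1 / (sqrt (- y3 J E) * sqrt (s J E \<phi> - y3 J E)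
       * (sqrt (- y3 J E) + sqrt (s J E \<phi> - y3 J E))))"

definition partials_exist :: "(real \<Rightarrow> real \<Rightarrow> real) \<Rightarrow> real \<Rightarrow> real \<Rightarrow> bool" where
  "partials_exist F J E \<longleftrightarrow>
     (\<lambda>e. F J e) differentiable (at E) \<and> (\<lambda>j. F j E) differentiable (at J)"

definition jacobian_det ::
    "(real \<Rightarrow> real \<Rightarrow> real) \<Rightarrow> (real \<Rightarrow> real \<Rightarrow> real) \<Rightarrow> real \<Rightarrow> real \<Rightarrow> real" where
  "jacobian_det F G J E =
     det (vector [vector [deriv (\<lambda>e. F J e) E, deriv (\<lambda>e. G J e) E],
                  vector [deriv (\<lambda>j. F j E) J, deriv (\<lambda>j. G j E) J]] :: real^2^2)"

definition Delta :: "real \<Rightarrow> real \<Rightarrow> real" where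
  "Delta J E = (if (J, E) \<notin> Gamma_plus then jacobian_det T Phi J E else jacobian_det T Psi J E)"

end

theory Submission
  imports Defs
begin

text \<open>Write \<open>a, b, c\<close> for the roots \<open>y\<^sub>1, y\<^sub>2, y\<^sub>3\<close> and \<open>\<sigma> = s - c\<close>. Vieta's formulas and the implicit
  derivatives \<open>\<partial>\<^sub>E a = 4a / ((a - b)(a - c))\<close>, \<open>\<partial>\<^sub>J a = - 4J / ((a - b)(a - c))\<close>, together with an
  integration by parts for \<open>Phi\<close>, express all four partial derivatives through
  \<open>X = \<integral> cos\<^sup>2 \<sigma>\<^sup>-\<^sup>3\<^sup>/\<^sup>2\<close> and \<open>Y = \<integral> sin\<^sup>2 \<sigma>\<^sup>-\<^sup>3\<^sup>/\<^sup>2\<close>, where \<open>X > Y > 0\<close>. Substituting \<open>a + b + c\<close> for \<open>2\<close>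
  makes the determinant homogeneous in the roots:
  it equals \<open>- 16/3 (a n\<^sub>b n\<^sub>c + b n\<^sub>a n\<^sub>c + c n\<^sub>a n\<^sub>b)\<close> with
  \<open>n\<^sub>a = - (X + 2Y) / (b - c)\<close>, \<open>n\<^sub>b = - (2X + Y) / (a - c)\<close>, \<open>n\<^sub>c = (X - Y) / (b - a)\<close>.
  Since \<open>c \<le> 0 \<le> a < b\<close>, no summand is positive and the middle one is negative.\<close>

section \<open>The roots of the cubic\<close>

text \<open>Vieta's formulas instead of the set of zeros: symmetric functions of the roots can then
  be substituted directly. The strict order makes all three roots simple, which fails both on the
  curve \<open>E = E_minus J\<close> and at the origin.\<close>

definition root_triple :: "real \<Rightarrow> real \<Rightarrow> real \<Rightarrow> real \<Rightarrow> real \<Rightarrow> bool" where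
  "root_triple J E a b c \<longleftrightarrow>
     c < a \<and> a < b \<and> a + b + c = 2 \<and> a * b + b * c + c * a = - 4 * E \<and> a * b * c = - 2 * J\<^sup>2"

lemma root_triple_less: "root_triple J E a b c \<Longrightarrow> c < a \<and> a < b"
  by (simp add: root_triple_def)

lemma root_triple_factor:
  assumes "root_triple J E a b c"
  shows "P J E y = - ((y - a) * (y - b) * (y - c))"
proof -
  have *: "2 = a + b + c" "4 * E = - (a * b + b * c + c * a)" "2 * J\<^sup>2 = - (a * b * c)"
    using assms by (auto simp: root_triple_def)
  have "P J E y = - (y ^ 3) + (a + b + c) * y\<^sup>2
      + - (a * b + b * c + c * a) * y - - (a * b * c)"
    unfolding P_def *(2,3) by (simp add: *(1)[symmetric])
  then show ?thesis
    by (simp add: algebra_simps power2_eq_square power3_eq_cube)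
qed

text \<open>The largest of three numbers with sum 2 is positive. Since the product of the roots is
  \<open>- 2 * J\<^sup>2\<close>, the other two then have a nonpositive product.\<close>

lemma root_triple_sign:
  assumes "root_triple J E a b c"
  shows "c \<le> 0" "0 \<le> a" "0 < b"
proof -
  show b: "0 < b"
    using assms by (auto simp: root_triple_def)
  have "a * c * b \<le> 0"
    using assms by (simp add: root_triple_def mult.commute mult.left_commute)
  then have "a * c \<le> 0"
    using b by (simp add: mult_le_0_iff)
  then show "c \<le> 0" "0 \<le> a"
    using assms by (auto simp: root_triple_def mult_le_0_iff)
qed

lemma root_triple_ordered_roots:
  assumes "root_triple J E a b c"
  shows "ordered_roots J E a b c"
  using root_triple_sign[OF assms] root_triple_less[OF assms]
  by (auto simp: ordered_roots_def root_triple_factor[OF assms])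

text \<open>Both triples list the zeros of the same polynomial, and the order tells which zero is
  which. This is what evaluates the definite descriptions \<open>y1\<close>, \<open>y2\<close>,
  \<open>y3\<close>.\<close>

lemma root_triple_unique:
  assumes "root_triple J E a b c" "ordered_roots J E a' b' c'"
  shows "a' = a \<and> b' = b \<and> c' = c"
proof -
  have lt: "c < a" "a < b" "c' \<le> a'" "a' < b'"
    using assms root_triple_less by (auto simp: ordered_roots_def)
  have eq: "{a', b', c'} = {a, b, c}"
    using assms(2) root_triple_ordered_roots[OF assms(1)] by (auto simp: ordered_roots_def)
  then have "a' \<in> {a, b, c}" "b' \<in> {a, b, c}" "c' \<in> {a, b, c}"
    "a \<in> {a', b', c'}" "b \<in> {a', b', c'}" "c \<in> {a', b', c'}"
    by blast+
  with lt show ?thesis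
    by auto
qed

lemma root_triple_y:
  assumes "root_triple J E a b c"
  shows "y1 J E = a" "y2 J E = b" "y3 J E = c"
  unfolding y1_def y2_def y3_def
  using root_triple_ordered_roots[OF assms] root_triple_unique[OF assms]
  by (blast intro: the_equality)+

text \<open>Divided differences: \<open>P J E a - P J E b\<close> is divided by
  \<open>a - b\<close>, likewise for \<open>a\<close> and \<open>c\<close>, and the difference of
  the two quotients by \<open>b - c\<close>. This yields the sum of the roots, then
  \<open>E\<close>, then \<open>J\<^sup>2\<close>.\<close>

lemma root_triple_of_zeros:
  assumes zero: "P J E a = 0" "P J E b = 0" "P J E c = 0" and lt: "c < a" "a < b"
  shows "root_triple J E a b c"
proof -
  have "(a - b) * (- (a\<^sup>2 + a * b + b\<^sup>2) + 2 * (a + b) + 4 * E) = P J E a - P J E b"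
    by (simp add: P_def algebra_simps power2_eq_square power3_eq_cube)
  then have ab: "- (a\<^sup>2 + a * b + b\<^sup>2) + 2 * (a + b) + 4 * E = 0"
    using zero lt by simp
  have "(a - c) * (- (a\<^sup>2 + a * c + c\<^sup>2) + 2 * (a + c) + 4 * E) = P J E a - P J E c"
    by (simp add: P_def algebra_simps power2_eq_square power3_eq_cube)
  then have ac: "- (a\<^sup>2 + a * c + c\<^sup>2) + 2 * (a + c) + 4 * E = 0"
    using zero lt by simp
  have "(b - c) * (a + b + c - 2) = 0"
    using ab ac by (simp add: algebra_simps power2_eq_square)
  then have sum: "a + b + c = 2"
    using lt by simp
  then have c: "c = 2 - a - b"
    by simp
  have E: "4 * E = a\<^sup>2 + a * b + b\<^sup>2 - 2 * (a + b)"
    using ab by simp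
  have J: "2 * J\<^sup>2 = - (a ^ 3) + 2 * a\<^sup>2 + 4 * E * a"
    using zero(1) by (simp add: P_def)
  have "a * b + b * c + c * a = - 4 * E"
    using E unfolding c by (simp add: algebra_simps power2_eq_square)
  moreover have "a * b * c = - 2 * J\<^sup>2"
    using J unfolding c E by (simp add: algebra_simps power2_eq_square power3_eq_cube)
  ultimately show ?thesis
    using lt sum by (simp add: root_triple_def)
qed

section \<open>Existence of the three roots on the domain\<close>

lemma continuous_P [continuous_intros]: "continuous_on S (P J E)"
  unfolding P_def by (intro continuous_intros)

text \<open>Makes the definite description in \<open>E_minus\<close> meaningful. For uniqueness,
  twice the cofactor of \<open>q - r\<close> in the difference of the two values is 2 plus a sum of
  squares.\<close>

lemma ex1_cubic: "\<exists>!q::real. J = q * (1 + q\<^sup>2)"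
proof -
  have "\<exists>q\<ge>- (\<bar>J\<bar>). q \<le> \<bar>J\<bar> \<and> q * (1 + q\<^sup>2) = J"
  proof (rule IVT')
    have "\<bar>J\<bar> * 1 \<le> \<bar>J\<bar> * (1 + J\<^sup>2)"
      by (intro mult_left_mono) auto
    then show "- \<bar>J\<bar> * (1 + (- \<bar>J\<bar>)\<^sup>2) \<le> J" "J \<le> \<bar>J\<bar> * (1 + \<bar>J\<bar>\<^sup>2)"
      by auto
  qed (auto intro!: continuous_intros)
  moreover have "q = r" if "q * (1 + q\<^sup>2) = r * (1 + r\<^sup>2)" for q r :: real
  proof -
    have "(q - r) * (2 + (q + r)\<^sup>2 + q\<^sup>2 + r\<^sup>2) = 2 * (q * (1 + q\<^sup>2) - r * (1 + r\<^sup>2))"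
      by (simp add: algebra_simps power2_eq_square)
    moreover have "0 < 2 + (q + r)\<^sup>2 + q\<^sup>2 + r\<^sup>2"
      by (intro add_pos_nonneg) auto
    ultimately show ?thesis
      using that by simp
  qed
  ultimately show ?thesis
    by metis
qed

text \<open>On the curve \<open>E = E_minus J\<close> the polynomial has the double root \<open>1 + q\<^sup>2\<close> and the simple
  root \<open>- 2 * q\<^sup>2\<close>; raising \<open>E\<close> makes \<open>P\<close> positive at \<open>1 + q\<^sup>2\<close>.\<close>

lemma Dom_root_triple:
  assumes "(J, E) \<in> Dom"
  obtains a b c where "root_triple J E a b c"
proof -
  obtain q where q: "J = q * (1 + q\<^sup>2)"
    using ex1_cubic by blast
  then have "(THE q. J = q * (1 + q\<^sup>2)) = q"
    using ex1_cubic by (intro the1_equality)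
  then have E: "(q\<^sup>2 + 1) * (3 * q\<^sup>2 - 1) / 4 < E"
    using assms by (simp add: Dom_def E_minus_def Let_def)
  let ?y = "1 + q\<^sup>2"
  have y: "0 < ?y"
    by (simp add: add_pos_nonneg)
  \<comment> \<open>For \<open>J = 0\<close> the value \<open>P J E 0\<close> vanishes and gives no
    sign for the intermediate value theorem, but the roots are explicit: 0 and 1 - r, 1 + r.\<close>
  show thesis
  proof (cases "J = 0")
    case True
    then have "q = 0"
      using q y by (metis less_irrefl mult_eq_0_iff)
    then have E4: "0 < 1 + 4 * E"
      using E by simp
    define r where "r = sqrt (1 + 4 * E)"
    have r: "0 < r" "r\<^sup>2 = 1 + 4 * E"
      using E4 by (auto simp: r_def)
    have "E \<noteq> 0"
      using True assms by (auto simp: Dom_def)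
    then have r1: "r \<noteq> 1"
      using r(2) by auto
    have "4 * E = r\<^sup>2 - 1"
      using r by simp
    then have "P J E x = - x * (x - (1 - r)) * (x - (1 + r))" for x
      by (simp only: P_def True) (simp add: algebra_simps power2_eq_square power3_eq_cube)
    then have zeros: "P J E 0 = 0" "P J E (1 - r) = 0" "P J E (1 + r) = 0"
      by simp_all
    show thesis
    \<comment> \<open>The sign of \<open>E\<close> decides whether 0 is the lowest root
      (\<open>r < 1\<close>, negative \<open>E\<close>) or the middle one.\<close>
    proof (cases "r < 1")
      case True
      then show thesis
        using that root_triple_of_zeros[of J E "1 - r" "1 + r" 0] zeros r by simp
    next
      case False
      then show thesis
        using that root_triple_of_zeros[of J E 0 "1 + r" "1 - r"] zeros r r1 by simp
    qed
  next
    case False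
    have P: "P J E x = - ((x - ?y)\<^sup>2 * (x + 2 * q\<^sup>2))
        + 4 * (E - (q\<^sup>2 + 1) * (3 * q\<^sup>2 - 1) / 4) * x" for x
      unfolding P_def q by (simp add: field_simps power2_eq_square power3_eq_cube)
    have py: "0 < P J E ?y"
      using E y unfolding P by simp
    have p0: "P J E 0 < 0"
      using False by (simp add: P_def)
    \<comment> \<open>Beyond \<open>R\<close> in absolute value the cubic term dominates, so
      \<open>P\<close> is positive at \<open>- R\<close> and negative from \<open>R\<close> on. With
      the signs at 0 and at the former double root this gives three sign changes.\<close>
    define R where "R = 3 + 4 * \<bar>E\<bar> + 2 * J\<^sup>2"
    have R: "3 \<le> R" "4 * \<bar>E\<bar> + 2 * J\<^sup>2 = R - 3"
      by (auto simp: R_def)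
    have big: "P J E x < 0" if "R \<le> x" for x
    proof -
      have x: "3 \<le> x" "4 * \<bar>E\<bar> + 2 * J\<^sup>2 \<le> x - 3"
        using that R by auto
      have "4 * E * x \<le> 4 * \<bar>E\<bar> * x"
        using x by (intro mult_right_mono) auto
      also have "\<dots> \<le> (x - 3) * x"
        using x by (intro mult_right_mono) (auto intro: order_trans[rotated])
      finally have "P J E x \<le> - (x ^ 3) + 2 * x\<^sup>2 + (x - 3) * x"
        by (simp add: P_def) (smt (verit) zero_le_power2)
      also have "\<dots> = - (x\<^sup>2 * (x - 3)) - 3 * x"
        by (simp add: algebra_simps power2_eq_square power3_eq_cube)
      also have "\<dots> < 0"
        using x by (smt (verit) mult_nonneg_nonneg zero_le_power2)
      finally show ?thesis .
    qed
    have small: "0 < P J E (- R)"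
    proof -
      have "4 * E * R \<le> 4 * \<bar>E\<bar> * R"
        using R by (intro mult_right_mono) auto
      moreover have "2 * J\<^sup>2 * 1 \<le> 2 * J\<^sup>2 * R"
        using R by (intro mult_left_mono) auto
      ultimately have "4 * E * R + 2 * J\<^sup>2 \<le> (4 * \<bar>E\<bar> + 2 * J\<^sup>2) * R"
        by (simp add: algebra_simps)
      also have "\<dots> = (R - 3) * R"
        using R by simp
      finally have "4 * E * R + 2 * J\<^sup>2 \<le> (R - 3) * R" .
      moreover have "0 < R ^ 3 + R\<^sup>2 + 3 * R"
        using R by (intro add_pos_pos) auto
      ultimately show ?thesis
        by (simp add: P_def algebra_simps power2_eq_square power3_eq_cube)
    qed
    have "\<exists>x\<ge>- R. x \<le> 0 \<and> P J E x = 0"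
      by (rule IVT2') (use small p0 R in \<open>auto intro: continuous_intros\<close>)
    then obtain c where c: "P J E c = 0" "c \<le> 0"
      by blast
    have "\<exists>x\<ge>0. x \<le> ?y \<and> P J E x = 0"
      by (rule IVT') (use py p0 y in \<open>auto intro: continuous_intros\<close>)
    then obtain a where a: "P J E a = 0" "0 \<le> a" "a \<le> ?y"
      by blast
    have "\<exists>x\<ge>?y. x \<le> max R ?y \<and> P J E x = 0"
      by (rule IVT2') (use py big[of "max R ?y"] in \<open>auto intro: continuous_intros less_imp_le\<close>)
    then obtain b where b: "P J E b = 0" "?y \<le> b"
      by blast
    \<comment> \<open>The signs at 0 and \<open>?y\<close> are strict, so these points are not roots
      and they separate c, a and b strictly.\<close>
    have "c \<noteq> 0" "a \<noteq> ?y" "b \<noteq> ?y"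
      using p0 py a b c by auto
    then show thesis
      using that root_triple_of_zeros[OF a(1) b(1) c(1)] a b c by auto
  qed
qed


section \<open>Continuity and differentiability of the roots in the parameters\<close>

lemma root_triple_near:
  assumes rt: "root_triple J E a b c"
    and j: "(j \<longlongrightarrow> J) F" and e: "(e \<longlongrightarrow> E) F" and d: "0 < d"
  shows "\<forall>\<^sub>F t in F. \<exists>a' b' c'. root_triple (j t) (e t) a' b' c' \<and>
           \<bar>a' - a\<bar> < d \<and> \<bar>b' - b\<bar> < d \<and> \<bar>c' - c\<bar> < d"
proof -
  \<comment> \<open>Half the gaps bound the radius, so the three intervals around the roots meet at
    most at endpoints.\<close>
  define \<delta> where "\<delta> = min d (min ((a - c) / 2) ((b - a) / 2))"
  have \<delta>: "0 < \<delta>" "\<delta> \<le> d" "c + \<delta> \<le> a - \<delta>" "a + \<delta> \<le> b - \<delta>"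
    using d root_triple_less[OF rt] by (auto simp: \<delta>_def min_def field_simps)
  have lim: "((\<lambda>t. P (j t) (e t) x) \<longlongrightarrow> P J E x) F" for x
    unfolding P_def by (intro tendsto_intros j e)
  \<comment> \<open>Simple roots are sign changes. Strict signs at finitely many points survive a
    small change of the parameters, and each interval then still contains a root.\<close>
  have signs: "0 < P J E (c - \<delta>)" "P J E (c + \<delta>) < 0" "P J E (a - \<delta>) < 0"
    "0 < P J E (a + \<delta>)" "0 < P J E (b - \<delta>)" "P J E (b + \<delta>) < 0"
    unfolding root_triple_factor[OF rt] using \<delta>
    by (auto simp: zero_less_mult_iff mult_less_0_iff)
  have "\<forall>\<^sub>F t in F. 0 < P (j t) (e t) (c - \<delta>)" "\<forall>\<^sub>F t in F. P (j t) (e t) (c + \<delta>) < 0"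
    "\<forall>\<^sub>F t in F. P (j t) (e t) (a - \<delta>) < 0" "\<forall>\<^sub>F t in F. 0 < P (j t) (e t) (a + \<delta>)"
    "\<forall>\<^sub>F t in F. 0 < P (j t) (e t) (b - \<delta>)" "\<forall>\<^sub>F t in F. P (j t) (e t) (b + \<delta>) < 0"
    using signs by (auto intro: order_tendstoD[OF lim])
  then show ?thesis
  proof eventually_elim
    case (elim t)
    have "\<exists>x\<ge>c - \<delta>. x \<le> c + \<delta> \<and> P (j t) (e t) x = 0"
      by (rule IVT2') (use elim \<delta> in \<open>auto intro: continuous_intros\<close>)
    then obtain c' where c': "c - \<delta> \<le> c'" "c' \<le> c + \<delta>" "P (j t) (e t) c' = 0"
      by blast
    have "\<exists>x\<ge>a - \<delta>. x \<le> a + \<delta> \<and> P (j t) (e t) x = 0"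
      by (rule IVT') (use elim \<delta> in \<open>auto intro: continuous_intros\<close>)
    then obtain a' where a': "a - \<delta> \<le> a'" "a' \<le> a + \<delta>" "P (j t) (e t) a' = 0"
      by blast
    have "\<exists>x\<ge>b - \<delta>. x \<le> b + \<delta> \<and> P (j t) (e t) x = 0"
      by (rule IVT2') (use elim \<delta> in \<open>auto intro: continuous_intros\<close>)
    then obtain b' where b': "b - \<delta> \<le> b'" "b' \<le> b + \<delta>" "P (j t) (e t) b' = 0"
      by blast
    \<comment> \<open>Strict signs exclude the endpoints, so the new roots are distinct even where
      two intervals touch.\<close>
    have "c' \<noteq> c - \<delta>" "c' \<noteq> c + \<delta>" "a' \<noteq> a - \<delta>" "a' \<noteq> a + \<delta>" "b' \<noteq> b - \<delta>" "b' \<noteq> b + \<delta>"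
      using elim a' b' c' by auto
    then have "\<bar>a' - a\<bar> < \<delta>" "\<bar>b' - b\<bar> < \<delta>" "\<bar>c' - c\<bar> < \<delta>"
      using a' b' c' by (auto simp: abs_less_iff)
    moreover from this have "root_triple (j t) (e t) a' b' c'"
      using \<delta> by (intro root_triple_of_zeros a' b' c') auto
    ultimately show ?case
      using \<delta> by (meson less_le_trans)
  qed
qed

lemma root_triple_eventually:
  assumes "root_triple J E a b c" "(j \<longlongrightarrow> J) F" "(e \<longlongrightarrow> E) F"
  shows "\<forall>\<^sub>F t in F. root_triple (j t) (e t) (y1 (j t) (e t)) (y2 (j t) (e t)) (y3 (j t) (e t))"
  using root_triple_near[OF assms zero_less_one]
  by eventually_elim (auto simp: root_triple_y)

lemma tendsto_roots:
  assumes "root_triple J E a b c" "(j \<longlongrightarrow> J) F" "(e \<longlongrightarrow> E) F"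
  shows "((\<lambda>t. y1 (j t) (e t)) \<longlongrightarrow> a) F" "((\<lambda>t. y2 (j t) (e t)) \<longlongrightarrow> b) F"
    "((\<lambda>t. y3 (j t) (e t)) \<longlongrightarrow> c) F"
proof -
  have "\<forall>\<^sub>F t in F. dist (y1 (j t) (e t)) a < d \<and> dist (y2 (j t) (e t)) b < d
      \<and> dist (y3 (j t) (e t)) c < d" if "0 < d" for d
    using root_triple_near[OF assms that]
    by eventually_elim (auto simp: root_triple_y dist_real_def)
  then have "\<forall>\<^sub>F t in F. dist (y1 (j t) (e t)) a < d"
    "\<forall>\<^sub>F t in F. dist (y2 (j t) (e t)) b < d" "\<forall>\<^sub>F t in F. dist (y3 (j t) (e t)) c < d"
    if "0 < d" for d
    using that by (auto simp: eventually_conj_iff)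
  then show "((\<lambda>t. y1 (j t) (e t)) \<longlongrightarrow> a) F" "((\<lambda>t. y2 (j t) (e t)) \<longlongrightarrow> b) F"
    "((\<lambda>t. y3 (j t) (e t)) \<longlongrightarrow> c) F"
    by (auto intro: tendstoI)
qed

text \<open>Implicit differentiation by hand. \<open>P\<close> is affine in \<open>e\<close> and in
  \<open>j\<^sup>2\<close>, so the equation at the moved root, factored at time t, expresses the
  difference quotient of \<open>y\<close> through those of \<open>e\<close> and
  \<open>j\<^sup>2\<close>. Continuity of \<open>y\<close> at a simple root is enough to pass to the
  limit.\<close>

lemma simple_root_has_derivative:
  fixes j e y :: "real \<Rightarrow> real"
  assumes dj: "(j has_real_derivative j') (at t)" and de: "(e has_real_derivative e') (at t)"
    and y: "(y \<longlongrightarrow> u) (at t)" "y t = u"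
    and zero: "\<forall>\<^sub>F \<tau> in at t. P (j \<tau>) (e \<tau>) (y \<tau>) = 0"
    and factor: "\<And>x. P (j t) (e t) x = - ((x - u) * (x - v) * (x - w))"
    and simple: "u \<noteq> v" "u \<noteq> w"
  shows "(y has_real_derivative (4 * u * e' - 4 * j t * j') / ((u - v) * (u - w))) (at t)"
proof -
  have "((\<lambda>\<tau>. (j \<tau>)\<^sup>2) has_real_derivative 2 * j t * j') (at t)"
    by (auto intro!: derivative_eq_intros dj)
  then have lims: "((\<lambda>\<tau>. ((j \<tau>)\<^sup>2 - (j t)\<^sup>2) / (\<tau> - t)) \<longlongrightarrow> 2 * j t * j') (at t)"
    "((\<lambda>\<tau>. (e \<tau> - e t) / (\<tau> - t)) \<longlongrightarrow> e') (at t)"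
    using de by (auto simp: has_field_derivative_iff)
  have "((\<lambda>\<tau>. (4 * y \<tau> * ((e \<tau> - e t) / (\<tau> - t)) - 2 * (((j \<tau>)\<^sup>2 - (j t)\<^sup>2) / (\<tau> - t)))
          / ((y \<tau> - v) * (y \<tau> - w)))
        \<longlongrightarrow> (4 * u * e' - 2 * (2 * j t * j')) / ((u - v) * (u - w))) (at t)"
    by (intro tendsto_intros y lims) (use simple in auto)
  moreover have "\<forall>\<^sub>F \<tau> in at t.
      (4 * y \<tau> * ((e \<tau> - e t) / (\<tau> - t)) - 2 * (((j \<tau>)\<^sup>2 - (j t)\<^sup>2) / (\<tau> - t)))
          / ((y \<tau> - v) * (y \<tau> - w)) = (y \<tau> - y t) / (\<tau> - t)"
    using zero tendsto_imp_eventually_ne[OF y(1) simple(1)]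
      tendsto_imp_eventually_ne[OF y(1) simple(2)] eventually_neq_at_within[of t]
  proof eventually_elim
    case (elim \<tau>)
    have "P (j \<tau>) (e \<tau>) (y \<tau>)
        = P (j t) (e t) (y \<tau>) + 4 * (e \<tau> - e t) * y \<tau> - 2 * ((j \<tau>)\<^sup>2 - (j t)\<^sup>2)"
      by (simp add: P_def algebra_simps)
    then have "4 * y \<tau> * (e \<tau> - e t) - 2 * ((j \<tau>)\<^sup>2 - (j t)\<^sup>2)
        = (y \<tau> - y t) * ((y \<tau> - v) * (y \<tau> - w))"
      using elim(1) unfolding factor y(2) by (simp add: algebra_simps)
    moreover have "4 * y \<tau> * ((e \<tau> - e t) / (\<tau> - t)) - 2 * (((j \<tau>)\<^sup>2 - (j t)\<^sup>2) / (\<tau> - t))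
        = (4 * y \<tau> * (e \<tau> - e t) - 2 * ((j \<tau>)\<^sup>2 - (j t)\<^sup>2)) / (\<tau> - t)"
      by (simp add: diff_divide_distrib[symmetric])
    ultimately show ?case
      using elim by simp
  qed
  ultimately show ?thesis
    unfolding has_field_derivative_iff by (simp add: tendsto_cong mult.assoc)
qed

lemma roots_have_derivative:
  assumes rt: "root_triple (j t) (e t) a b c"
    and dj: "(j has_real_derivative j') (at t)" and de: "(e has_real_derivative e') (at t)"
  shows "((\<lambda>\<tau>. y1 (j \<tau>) (e \<tau>)) has_real_derivative
           (4 * a * e' - 4 * j t * j') / ((a - b) * (a - c))) (at t)"
    and "((\<lambda>\<tau>. y2 (j \<tau>) (e \<tau>)) has_real_derivative
           (4 * b * e' - 4 * j t * j') / ((b - a) * (b - c))) (at t)"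
    and "((\<lambda>\<tau>. y3 (j \<tau>) (e \<tau>)) has_real_derivative
           (4 * c * e' - 4 * j t * j') / ((c - a) * (c - b))) (at t)"
proof -
  have "isCont j t" "isCont e t"
    using dj de by (auto intro: DERIV_isCont)
  then have lim: "(j \<longlongrightarrow> j t) (at t)" "(e \<longlongrightarrow> e t) (at t)"
    by (auto simp: isCont_def)
  note factor = root_triple_factor[OF rt]
  note zeros = root_triple_eventually[OF rt lim]
  show "((\<lambda>\<tau>. y1 (j \<tau>) (e \<tau>)) has_real_derivative
           (4 * a * e' - 4 * j t * j') / ((a - b) * (a - c))) (at t)"
    by (rule simple_root_has_derivative[OF dj de tendsto_roots(1)[OF rt lim]])
      (use zeros root_triple_less[OF rt] in
        \<open>auto simp: factor root_triple_y[OF rt] root_triple_factor elim!: eventually_mono\<close>)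
  show "((\<lambda>\<tau>. y2 (j \<tau>) (e \<tau>)) has_real_derivative
           (4 * b * e' - 4 * j t * j') / ((b - a) * (b - c))) (at t)"
    by (rule simple_root_has_derivative[OF dj de tendsto_roots(2)[OF rt lim]])
      (use zeros root_triple_less[OF rt] in
        \<open>auto simp: factor root_triple_y[OF rt] root_triple_factor elim!: eventually_mono\<close>)
  show "((\<lambda>\<tau>. y3 (j \<tau>) (e \<tau>)) has_real_derivative
           (4 * c * e' - 4 * j t * j') / ((c - a) * (c - b))) (at t)"
    by (rule simple_root_has_derivative[OF dj de tendsto_roots(3)[OF rt lim]])
      (use zeros root_triple_less[OF rt] in
        \<open>auto simp: factor root_triple_y[OF rt] root_triple_factor elim!: eventually_mono\<close>)
qed

section \<open>Integrals depending on the roots\<close>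

text \<open>Differentiation under the integral sign for several parameters, with the derivative
  written as a gradient \<open>g\<close>. The proof turns \<open>g\<close> into a bounded linear
  functional and integrates that.\<close>

lemma leibniz_rule_gradient:
  fixes f :: "'a::euclidean_space \<Rightarrow> real \<Rightarrow> real" and g :: "'a \<Rightarrow> real \<Rightarrow> 'a"
  assumes deriv: "\<And>x t. x \<in> U \<Longrightarrow> t \<in> {l..u} \<Longrightarrow> ((\<lambda>x. f x t) has_derivative (\<lambda>y. g x t \<bullet> y)) (at x)"
    and f: "\<And>x. x \<in> U \<Longrightarrow> continuous_on {l..u} (f x)"
    and g: "continuous_on (U \<times> {l..u}) (\<lambda>(x, t). g x t)"
    and U: "convex U" "open U" "x0 \<in> U"
  shows "((\<lambda>x. integral {l..u} (f x)) has_derivative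
    (\<lambda>y. integral {l..u} (\<lambda>t. g x0 t \<bullet> y))) (at x0)"
proof -
  have G: "continuous_on (U \<times> cbox l u) (\<lambda>(x, t). blinfun_inner_left (g x t))"
    using bounded_linear.continuous_on[OF bounded_linear_blinfun_inner_left g]
    by (simp add: case_prod_unfold)
  have "continuous_on {l..u} (\<lambda>t. (x0, t))"
    by (intro continuous_intros)
  then have "continuous_on {l..u} (\<lambda>t. blinfun_inner_left (g x0 t))"
    using continuous_on_compose2[OF G, of "{l..u}" "\<lambda>t. (x0, t)"] U by auto
  then have int: "(\<lambda>t. blinfun_inner_left (g x0 t)) integrable_on {l..u}"
    by (rule integrable_continuous_real)
  have "((\<lambda>x. integral (cbox l u) (f x)) has_derivative
      integral (cbox l u) (\<lambda>t. blinfun_inner_left (g x0 t))) (at x0 within U)"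
  proof (rule leibniz_rule[OF _ _ G U(3,1)])
    show "((\<lambda>x. f x t) has_derivative blinfun_inner_left (g x t)) (at x within U)"
      if "x \<in> U" "t \<in> cbox l u" for x t
    proof -
      have "blinfun_apply (blinfun_inner_left (g x t)) = (\<lambda>y. g x t \<bullet> y)"
        by (intro ext) (simp add: inner_commute)
      then show ?thesis
        using deriv[of x t] that by (auto intro: has_derivative_at_withinI)
    qed
    show "f x integrable_on cbox l u" if "x \<in> U" for x
      using f[OF that] by (auto intro: integrable_continuous_real)
  qed
  moreover have "blinfun_apply (integral (cbox l u) (\<lambda>t. blinfun_inner_left (g x0 t)))
      = (\<lambda>y. integral {l..u} (\<lambda>t. g x0 t \<bullet> y))"
    using int by (intro ext) (simp add: blinfun_apply_integral inner_commute)
  ultimately show ?thesis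
    using U by (simp only: at_within_open cbox_interval)
qed

text \<open>\<open>a * cos\<^sup>2 + b * sin\<^sup>2\<close> runs between \<open>a\<close> and \<open>b\<close>, so a convex \<open>U\<close> need only contain the two
  endpoints.\<close>

lemma cos_sin_convex_mem:
  fixes a b c x :: real
  assumes "convex U" "(a, c) \<in> U" "(b, c) \<in> U"
  shows "(a * (cos x)\<^sup>2 + b * (sin x)\<^sup>2, c) \<in> U"
proof -
  have "(cos x)\<^sup>2 *\<^sub>R (a, c) + (sin x)\<^sup>2 *\<^sub>R (b, c) \<in> U"
    using assms by (intro convexD) auto
  moreover have "(cos x)\<^sup>2 * c + (sin x)\<^sup>2 * c = c"
    by (metis distrib_right mult_1 sin_cos_squared_add2)
  ultimately show ?thesis
    by (simp add: mult.commute)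
qed

lemma continuous_cos_sin_integrand:
  fixes h :: "real \<times> real \<Rightarrow> real"
  assumes "convex U" "continuous_on U h" "(a, c) \<in> U" "(b, c) \<in> U"
  shows "continuous_on S (\<lambda>x. h (a * (cos x)\<^sup>2 + b * (sin x)\<^sup>2, c))"
  by (rule continuous_on_compose2[OF assms(2)])
    (use assms cos_sin_convex_mem in \<open>auto intro!: continuous_intros\<close>)

text \<open>The integral is first differentiated as a function of three independent variables, then
  composed with the path (A, B, C). Here \<open>h1\<close> and \<open>h2\<close> are the partial
  derivatives of \<open>h\<close>, and the weights cos^2 and sin^2 come from the dependence of the
  first argument on A and B.\<close>

lemma cos_sin_integral_has_derivative:
  fixes h h1 h2 :: "real \<times> real \<Rightarrow> real" and A B C :: "real \<Rightarrow> real"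
  assumes U: "convex U" "open U"
    and h: "\<And>p. p \<in> U \<Longrightarrow> (h has_derivative (\<lambda>(x, y). h1 p * x + h2 p * y)) (at p)"
    and cont: "continuous_on U h1" "continuous_on U h2"
    and mem: "(a, c) \<in> U" "(b, c) \<in> U"
    and deriv: "(A has_real_derivative a') (at t)" "(B has_real_derivative b') (at t)"
      "(C has_real_derivative c') (at t)"
    and val: "A t = a" "B t = b" "C t = c"
  shows "((\<lambda>\<tau>. integral {l..u} (\<lambda>x. h (A \<tau> * (cos x)\<^sup>2 + B \<tau> * (sin x)\<^sup>2, C \<tau>)))
     has_real_derivative
       a' * integral {l..u} (\<lambda>x. h1 (a * (cos x)\<^sup>2 + b * (sin x)\<^sup>2, c) * (cos x)\<^sup>2)
     + b' * integral {l..u} (\<lambda>x. h1 (a * (cos x)\<^sup>2 + b * (sin x)\<^sup>2, c) * (sin x)\<^sup>2)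
     + c' * integral {l..u} (\<lambda>x. h2 (a * (cos x)\<^sup>2 + b * (sin x)\<^sup>2, c))) (at t)"
proof -
  \<comment> \<open>The triples whose two endpoint pairs lie in \<open>U\<close>. As an intersection
    of preimages under linear maps, this set inherits convexity and openness.\<close>
  define V where "V = {p. (fst p, snd (snd p)) \<in> U} \<inter> {p. (fst (snd p), snd (snd p)) \<in> U}"
  have lin: "linear (\<lambda>p::real \<times> real \<times> real. (fst p, snd (snd p)))"
    "linear (\<lambda>p::real \<times> real \<times> real. (fst (snd p), snd (snd p)))"
    by (auto intro!: linearI)
  have V: "convex V" "open V"
  proof -
    have "V = (\<lambda>p. (fst p, snd (snd p))) -` U \<inter> (\<lambda>p. (fst (snd p), snd (snd p))) -` U"
      by (auto simp: V_def)
    then show "convex V" "open V"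
      using U lin
      by (auto intro!: convex_Int convex_linear_vimage open_Int open_vimage continuous_intros)
  qed
  have memV: "(x * (cos s)\<^sup>2 + y * (sin s)\<^sup>2, z) \<in> U" if "(x, y, z) \<in> V" for x y z s
    using that cos_sin_convex_mem[OF U(1)] by (auto simp: V_def)
  define q where "q p s = (fst p * (cos s)\<^sup>2 + fst (snd p) * (sin s)\<^sup>2, snd (snd p))"
    for p :: "real \<times> real \<times> real" and s :: real
  have qU: "q p s \<in> U" if "p \<in> V" for p s
    using memV[of "fst p" "fst (snd p)" "snd (snd p)"] that by (auto simp: q_def)
  let ?f = "\<lambda>p s. h (q p s)"
  let ?g = "\<lambda>p s. (h1 (q p s) * (cos s)\<^sup>2, h1 (q p s) * (sin s)\<^sup>2, h2 (q p s))"
  have conth: "continuous_on U h"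
    using h by (auto intro!: continuous_at_imp_continuous_on has_derivative_continuous)
  have int: "((\<lambda>p. integral {l..u} (?f p)) has_derivative
      (\<lambda>y. integral {l..u} (\<lambda>s. ?g (a, b, c) s \<bullet> y))) (at (a, b, c))"
  proof (rule leibniz_rule_gradient[OF _ _ _ V])
    show "((\<lambda>p. ?f p s) has_derivative (\<lambda>y. ?g p s \<bullet> y)) (at p)"
      if p: "p \<in> V" for p s
    proof -
      have "((\<lambda>p. q p s) has_derivative
          (\<lambda>y. (fst y * (cos s)\<^sup>2 + fst (snd y) * (sin s)\<^sup>2, snd (snd y)))) (at p)"
        unfolding q_def by (auto intro!: derivative_eq_intros)
      from has_derivative_compose[OF this h[OF qU[OF p]]] show ?thesis
        by (rule has_derivative_eq_rhs) (auto simp: algebra_simps)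
    qed
    show "continuous_on {l..u} (?f p)" if "p \<in> V" for p
      by (rule continuous_on_compose2[OF conth])
        (use that qU in \<open>auto simp: q_def intro!: continuous_intros\<close>)
    have "continuous_on (V \<times> {l..u}) (\<lambda>z. q (fst z) (snd z))"
      unfolding q_def by (intro continuous_intros)
    then have "continuous_on (V \<times> {l..u}) (\<lambda>z. h1 (q (fst z) (snd z)))"
      "continuous_on (V \<times> {l..u}) (\<lambda>z. h2 (q (fst z) (snd z)))"
      using qU by (auto intro!: continuous_on_compose2[OF cont(1)] continuous_on_compose2[OF cont(2)])
    then show "continuous_on (V \<times> {l..u}) (\<lambda>(p, s). ?g p s)"
      unfolding case_prod_unfold by (intro continuous_intros)
    show "(a, b, c) \<in> V"
      using mem by (simp add: V_def)
  qed
  have "((\<lambda>\<tau>. (A \<tau>, B \<tau>, C \<tau>)) has_derivative (\<lambda>y. (a' * y, b' * y, c' * y))) (at t)"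
    using deriv unfolding has_field_derivative_def by (intro has_derivative_Pair)
  moreover have "((\<lambda>p. integral {l..u} (?f p)) has_derivative
      (\<lambda>y. integral {l..u} (\<lambda>s. ?g (a, b, c) s \<bullet> y))) (at (A t, B t, C t))"
    using int by (simp only: val)
  ultimately have chain: "((\<lambda>\<tau>. integral {l..u} (?f (A \<tau>, B \<tau>, C \<tau>))) has_derivative
      (\<lambda>y. integral {l..u} (\<lambda>s. ?g (a, b, c) s \<bullet> (a' * y, b' * y, c' * y)))) (at t)"
    by (rule has_derivative_compose)
  let ?h1 = "\<lambda>x. h1 (a * (cos x)\<^sup>2 + b * (sin x)\<^sup>2, c)"
  let ?h2 = "\<lambda>x. h2 (a * (cos x)\<^sup>2 + b * (sin x)\<^sup>2, c)"
  have c12: "continuous_on {l..u} ?h1" "continuous_on {l..u} ?h2"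
    using continuous_cos_sin_integrand[OF U(1)] cont mem by blast+
  let ?D = "a' * integral {l..u} (\<lambda>x. ?h1 x * (cos x)\<^sup>2) + b' * integral {l..u} (\<lambda>x. ?h1 x * (sin x)\<^sup>2)
      + c' * integral {l..u} ?h2"
  have "integral {l..u} (\<lambda>s. ?g (a, b, c) s \<bullet> (a' * y, b' * y, c' * y)) = ?D * y" for y
  proof (rule integral_unique)
    have "((\<lambda>x. (a' * (?h1 x * (cos x)\<^sup>2) + b' * (?h1 x * (sin x)\<^sup>2) + c' * ?h2 x) * y)
        has_integral ?D * y) {l..u}"
      by (intro has_integral_mult_left has_integral_add has_integral_mult_right
          integrable_integral integrable_continuous_real continuous_intros c12)
    moreover have "?g (a, b, c) s \<bullet> (a' * y, b' * y, c' * y)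
        = (a' * (?h1 s * (cos s)\<^sup>2) + b' * (?h1 s * (sin s)\<^sup>2) + c' * ?h2 s) * y" for s
      by (simp add: q_def algebra_simps)
    ultimately show "((\<lambda>s. ?g (a, b, c) s \<bullet> (a' * y, b' * y, c' * y)) has_integral ?D * y) {l..u}"
      by simp
  qed
  then have "(\<lambda>y. integral {l..u} (\<lambda>s. ?g (a, b, c) s \<bullet> (a' * y, b' * y, c' * y))) = (*) ?D"
    by (rule ext)
  with chain show ?thesis
    unfolding has_field_derivative_def by (simp only: q_def fst_conv snd_conv)
qed

text \<open>The continuous counterpart, for \<open>Psi\<close> at \<open>J = 0\<close>: there the
  factor \<open>J\<close> already vanishes and only the limit of the integral matters.\<close>

lemma cos_sin_integral_tendsto:
  fixes h :: "real \<times> real \<Rightarrow> real" and A B C :: "'t \<Rightarrow> real"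
  assumes U: "convex U" "open U" and h: "continuous_on U h" and mem: "(a, c) \<in> U" "(b, c) \<in> U"
    and lim: "(A \<longlongrightarrow> a) F" "(B \<longlongrightarrow> b) F" "(C \<longlongrightarrow> c) F"
  shows "((\<lambda>\<tau>. integral {l..u} (\<lambda>x. h (A \<tau> * (cos x)\<^sup>2 + B \<tau> * (sin x)\<^sup>2, C \<tau>))) \<longlongrightarrow>
    integral {l..u} (\<lambda>x. h (a * (cos x)\<^sup>2 + b * (sin x)\<^sup>2, c))) F"
proof -
  define V where "V = (\<lambda>p. (fst p, snd (snd p))) -` U \<inter> (\<lambda>p. (fst (snd p), snd (snd p))) -` U"
  have V: "open V"
    unfolding V_def using U by (intro open_Int open_vimage continuous_intros)
  define q where "q p s = (fst p * (cos s)\<^sup>2 + fst (snd p) * (sin s)\<^sup>2, snd (snd p))"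
    for p :: "real \<times> real \<times> real" and s :: real
  have "q p s \<in> U" if "p \<in> V" for p s
    unfolding q_def using that by (intro cos_sin_convex_mem[OF U(1)]) (auto simp: V_def)
  moreover have "continuous_on (V \<times> cbox l u) (\<lambda>z. q (fst z) (snd z))"
    unfolding q_def by (intro continuous_intros)
  ultimately have "continuous_on (V \<times> cbox l u) (\<lambda>(p, s). h (q p s))"
    unfolding case_prod_unfold by (intro continuous_on_compose2[OF h]) auto
  then have "continuous_on V (\<lambda>p. integral (cbox l u) (\<lambda>s. h (q p s)))"
    by (rule integral_continuous_on_param)
  moreover have "(a, b, c) \<in> V"
    using mem by (simp add: V_def)
  ultimately have "isCont (\<lambda>p. integral (cbox l u) (\<lambda>s. h (q p s))) (a, b, c)"
    using V by (simp add: continuous_on_eq_continuous_at)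
  from isCont_tendsto_compose[OF this tendsto_Pair[OF lim(1) tendsto_Pair[OF lim(2,3)]]]
  show ?thesis
    by (simp add: q_def)
qed

section \<open>The period\<close>

lemma snd_less_fst_halfspace:
  "convex {p::real \<times> real. snd p < fst p}" "open {p::real \<times> real. snd p < fst p}"
proof -
  have "{p::real \<times> real. snd p < fst p} = {x. (-1, 1) \<bullet> x < 0}"
    by (auto simp: inner_prod_def)
  then show "convex {p::real \<times> real. snd p < fst p}" "open {p::real \<times> real. snd p < fst p}"
    by (simp_all add: convex_halfspace_lt open_halfspace_lt)
qed

lemma cos_sin_diff_pos:
  fixes a b c x :: real
  assumes "c < a" "c < b"
  shows "0 < a * (cos x)\<^sup>2 + b * (sin x)\<^sup>2 - c"
  using cos_sin_convex_mem[OF snd_less_fst_halfspace(1), of a c b x] assms by simp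

lemma integral_pos:
  fixes f :: "real \<Rightarrow> real"
  assumes "continuous_on {l..u} f" "l < u" "\<And>x. 0 \<le> f x" "z \<in> {l..u}" "f z \<noteq> 0"
  shows "0 < integral {l..u} f"
  using integral_eq_0_iff[OF assms(1,2,3)] assms(4,5)
    integral_nonneg[OF integrable_continuous_real[OF assms(1)] assms(3)]
  by (metis less_le)

lemma has_integral_of_derivative:
  fixes F f :: "real \<Rightarrow> real"
  assumes "l \<le> u" "\<And>x. (F has_real_derivative f x) (at x)"
  shows "(f has_integral F u - F l) {l..u}"
  using assms
  by (intro fundamental_theorem_of_calculus)
    (auto simp: has_real_derivative_iff_has_vector_derivative[symmetric]
      intro: has_field_derivative_at_within)

text \<open>This is X of the overview, and \<open>sin_moment\<close> is Y. They are - 2 times the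
  derivatives of the integral of 1 / \<open>sqrt \<sigma>\<close> with respect to \<open>a\<close>
  and \<open>b\<close>.\<close>

definition cos_moment :: "real \<Rightarrow> real \<Rightarrow> real \<Rightarrow> real" where
  "cos_moment a b c = integral {0..pi / 2} (\<lambda>x.
     let \<sigma> = a * (cos x)\<^sup>2 + b * (sin x)\<^sup>2 - c in (cos x)\<^sup>2 / (\<sigma> * sqrt \<sigma>))"

definition sin_moment :: "real \<Rightarrow> real \<Rightarrow> real \<Rightarrow> real" where
  "sin_moment a b c = integral {0..pi / 2} (\<lambda>x.
     let \<sigma> = a * (cos x)\<^sup>2 + b * (sin x)\<^sup>2 - c in (sin x)\<^sup>2 / (\<sigma> * sqrt \<sigma>))"

text \<open>Twice the derivative of the integral of 1 / \<open>sqrt \<sigma>\<close> when the roots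
  move with velocities u / ((a - b)(a - c)), v / ((b - a)(b - c)), w / ((c - a)(c - b)). By the
  implicit derivatives, the weights (a, b, c) belong to \<open>E\<close> and (1, 1, 1) to
  \<open>J\<close>, up to constants and a factor \<open>J\<close>.\<close>

definition moment_sum :: "real \<Rightarrow> real \<Rightarrow> real \<Rightarrow> real \<Rightarrow> real \<Rightarrow> real \<Rightarrow> real" where
  "moment_sum a b c u v w =
     - (u * cos_moment a b c) / ((a - b) * (a - c)) - v * sin_moment a b c / ((b - a) * (b - c))
     + w * (cos_moment a b c + sin_moment a b c) / ((c - a) * (c - b))"

lemma cos_moment_has_integral:
  assumes "c < a" "c < b"
  shows "((\<lambda>x. (cos x)\<^sup>2 / ((a * (cos x)\<^sup>2 + b * (sin x)\<^sup>2 - c) * sqrt (a * (cos x)\<^sup>2 + b * (sin x)\<^sup>2 - c)))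
    has_integral cos_moment a b c) {0..pi / 2}"
  unfolding cos_moment_def Let_def
  using cos_sin_diff_pos[OF assms]
  by (intro integrable_integral integrable_continuous_real continuous_intros)
    (auto simp: less_imp_neq[symmetric])

lemma sin_moment_has_integral:
  assumes "c < a" "c < b"
  shows "((\<lambda>x. (sin x)\<^sup>2 / ((a * (cos x)\<^sup>2 + b * (sin x)\<^sup>2 - c) * sqrt (a * (cos x)\<^sup>2 + b * (sin x)\<^sup>2 - c)))
    has_integral sin_moment a b c) {0..pi / 2}"
  unfolding sin_moment_def Let_def
  using cos_sin_diff_pos[OF assms]
  by (intro integrable_integral integrable_continuous_real continuous_intros)
    (auto simp: less_imp_neq[symmetric])

lemma moment_add_has_integral:
  assumes "c < a" "c < b"
  shows "((\<lambda>x. 1 / ((a * (cos x)\<^sup>2 + b * (sin x)\<^sup>2 - c) * sqrt (a * (cos x)\<^sup>2 + b * (sin x)\<^sup>2 - c)))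
    has_integral cos_moment a b c + sin_moment a b c) {0..pi / 2}"
  using has_integral_add[OF cos_moment_has_integral[OF assms] sin_moment_has_integral[OF assms]]
  by (simp add: add_divide_distrib[symmetric])

lemma sin_moment_pos:
  assumes "c < a" "c < b"
  shows "0 < sin_moment a b c"
proof -
  have pos: "0 < a * (cos x)\<^sup>2 + b * (sin x)\<^sup>2 - c" for x
    using assms by (rule cos_sin_diff_pos)
  let ?f = "\<lambda>x. (sin x)\<^sup>2 /
    ((a * (cos x)\<^sup>2 + b * (sin x)\<^sup>2 - c) * sqrt (a * (cos x)\<^sup>2 + b * (sin x)\<^sup>2 - c))"
  have cont: "continuous_on {0..pi / 2} ?f"
    using pos by (intro continuous_intros) (auto simp: less_imp_neq[symmetric])
  have nonneg: "0 \<le> ?f x" for x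
    using pos[of x] by simp
  then have "0 < integral {0..pi / 2} ?f"
    using assms by (intro integral_pos[OF cont, where z = "pi / 2"]) auto
  then show ?thesis
    by (simp add: sin_moment_def Let_def)
qed

text \<open>The factor \<open>\<sigma>\<^sup>-\<^sup>3\<^sup>/\<^sup>2\<close> is decreasing and \<open>cos\<^sup>2 - sin\<^sup>2\<close> has mean zero, so
  subtracting from \<open>\<sigma>\<^sup>-\<^sup>3\<^sup>/\<^sup>2\<close> its value where \<open>cos\<^sup>2 = sin\<^sup>2\<close> makes the integrand nonnegative.\<close>

lemma sin_moment_less_cos_moment:
  assumes "c < a" "a < b"
  shows "sin_moment a b c < cos_moment a b c"
proof -
  let ?s = "\<lambda>x. a * (cos x)\<^sup>2 + b * (sin x)\<^sup>2 - c"
  have pos: "0 < ?s x" for x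
    using assms by (intro cos_sin_diff_pos) auto
  have nz: "?s x \<noteq> 0" for x
    using pos[of x] by simp
  define m where "m = (a + b) / 2 - c"
  have m: "0 < m"
    using assms by (simp add: m_def)
  let ?k = "\<lambda>t::real. 1 / (t * sqrt t)"
  let ?d = "\<lambda>x::real. (cos x)\<^sup>2 - (sin x)\<^sup>2"
  let ?f = "\<lambda>x. ?d x * (?k (?s x) - ?k m)"
  have mono: "?k t \<le> ?k r" if "0 < r" "r \<le> t" for r t
    using that by (intro divide_left_mono mult_mono mult_pos_pos) auto
  \<comment> \<open>The value \<open>m\<close> of \<sigma> at pi / 4 is exceeded exactly where sin^2
    exceeds cos^2, so both factors of \<open>?f\<close> always have the same sign.\<close>
  have sm: "?s x - m = - ((b - a) / 2 * ?d x)" for x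
    unfolding m_def cos_squared_eq[of x] by (simp add: field_simps)
  have nonneg: "0 \<le> ?f x" for x
  proof (cases "0 \<le> ?d x")
    case True
    then have "?s x \<le> m"
      using sm[of x] assms by (smt (verit) mult_nonneg_nonneg divide_nonneg_pos)
    then show ?thesis
      using True mono[OF pos] by (intro mult_nonneg_nonneg) auto
  next
    case False
    then have "m \<le> ?s x"
      using sm[of x] assms by (smt (verit) mult_nonneg_nonpos divide_nonneg_pos)
    then show ?thesis
      using False mono[OF m] by (intro mult_nonpos_nonpos) auto
  qed
  have cont: "continuous_on {0..pi / 2} ?f"
    using nz m by (intro continuous_intros) auto
  \<comment> \<open>At x = 0 one has \<sigma> = a - c < m, so the integrand is positive there and
    the inequality becomes strict.\<close>
  have "?k m < ?k (a - c)"
    using assms m by (intro divide_strict_left_mono mult_strict_mono mult_pos_pos) (auto simp: m_def)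
  then have "0 < integral {0..pi / 2} ?f"
    using nonneg by (intro integral_pos[OF cont, where z = 0]) auto
  have "((\<lambda>x. (cos x)\<^sup>2 / (?s x * sqrt (?s x)) - (sin x)\<^sup>2 / (?s x * sqrt (?s x)) - ?k m * ?d x)
      has_integral cos_moment a b c - sin_moment a b c - ?k m * 0) {0..pi / 2}"
  proof (intro has_integral_diff has_integral_mult_right)
    show "((\<lambda>x. (cos x)\<^sup>2 / (?s x * sqrt (?s x))) has_integral cos_moment a b c) {0..pi / 2}"
      "((\<lambda>x. (sin x)\<^sup>2 / (?s x * sqrt (?s x))) has_integral sin_moment a b c) {0..pi / 2}"
      using assms by (simp_all add: cos_moment_has_integral sin_moment_has_integral)
    have "((\<lambda>x. sin x * cos x) has_real_derivative ?d x) (at x)" for x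
      by (auto intro!: derivative_eq_intros simp: power2_eq_square)
    then show "(?d has_integral 0) {0..pi / 2}"
      using has_integral_of_derivative[of 0 "pi / 2" "\<lambda>x. sin x * cos x" ?d] by simp
  qed
  moreover have "(\<lambda>x. (cos x)\<^sup>2 / (?s x * sqrt (?s x)) - (sin x)\<^sup>2 / (?s x * sqrt (?s x)) - ?k m * ?d x) = ?f"
    by (intro ext) (simp add: algebra_simps diff_divide_distrib)
  ultimately have "integral {0..pi / 2} ?f = cos_moment a b c - sin_moment a b c - ?k m * 0"
    by (simp only: integral_unique)
  with \<open>0 < integral {0..pi / 2} ?f\<close> show ?thesis
    by simp
qed

lemma inverse_sqrt_has_derivative:
  fixes u :: real
  assumes "0 < u"
  shows "((\<lambda>u. 1 / sqrt u) has_real_derivative - (1 / (u * sqrt u) / 2)) (at u)"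
  using assms by (auto intro!: derivative_eq_intros simp: divide_simps)

lemma inverse_sqrt_diff_has_derivative:
  fixes p :: "real \<times> real"
  assumes "snd p < fst p"
  shows "((\<lambda>p. 1 / sqrt (fst p - snd p)) has_derivative
    (\<lambda>(x, y). - (1 / ((fst p - snd p) * sqrt (fst p - snd p)) / 2) * x
      + 1 / ((fst p - snd p) * sqrt (fst p - snd p)) / 2 * y)) (at p)"
proof -
  have "((\<lambda>u. 1 / sqrt u) has_real_derivative
      - (1 / ((fst p - snd p) * sqrt (fst p - snd p)) / 2)) (at (fst p - snd p))"
    using assms by (intro inverse_sqrt_has_derivative) simp
  moreover have "((\<lambda>p. fst p - snd p) has_derivative (\<lambda>q. fst q - snd q)) (at p)"
    by (auto intro!: derivative_eq_intros)
  ultimately show ?thesis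
    by (rule has_derivative_eq_rhs[OF DERIV_compose_FDERIV])
      (auto simp: fun_eq_iff case_prod_unfold algebra_simps diff_divide_distrib)
qed

lemma moment_sum_arith:
  fixes X Y :: real
  shows "2 * k * ((4 * a * e - 4 * j * d) * u * - (X / 2) + (4 * b * e - 4 * j * d) * v * - (Y / 2)
        + (4 * c * e - 4 * j * d) * w * ((X + Y) / 2))
      = 4 * k * (e * (- (a * X) * u - b * Y * v + c * (X + Y) * w)
        - j * d * (- (1 * X) * u - 1 * Y * v + 1 * (X + Y) * w))"
  by (simp add: field_simps)

text \<open>Stated along a path, so that both partial derivatives are instances with (j', e') = (0,
  1) and (1, 0).\<close>

lemma T_has_derivative:
  assumes rt: "root_triple (j t) (e t) a b c"
    and dj: "(j has_real_derivative j') (at t)" and de: "(e has_real_derivative e') (at t)"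
  shows "((\<lambda>\<tau>. T (j \<tau>) (e \<tau>)) has_real_derivative
    4 * sqrt 2 * (e' * moment_sum a b c a b c - j t * j' * moment_sum a b c 1 1 1)) (at t)"
proof -
  note lt = root_triple_less[OF rt]
  let ?U = "{p::real \<times> real. snd p < fst p}"
  let ?h = "\<lambda>p::real \<times> real. 1 / sqrt (fst p - snd p)"
  let ?k = "\<lambda>p::real \<times> real. 1 / ((fst p - snd p) * sqrt (fst p - snd p))"
  let ?q = "\<lambda>x. (a * (cos x)\<^sup>2 + b * (sin x)\<^sup>2, c)"
  have "((\<lambda>\<tau>. integral {0..pi / 2} (\<lambda>x. ?h (y1 (j \<tau>) (e \<tau>) * (cos x)\<^sup>2 + y2 (j \<tau>) (e \<tau>) * (sin x)\<^sup>2, y3 (j \<tau>) (e \<tau>))))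
     has_real_derivative
       (4 * a * e' - 4 * j t * j') / ((a - b) * (a - c)) * integral {0..pi / 2} (\<lambda>x. - (?k (?q x) / 2) * (cos x)\<^sup>2)
     + (4 * b * e' - 4 * j t * j') / ((b - a) * (b - c)) * integral {0..pi / 2} (\<lambda>x. - (?k (?q x) / 2) * (sin x)\<^sup>2)
     + (4 * c * e' - 4 * j t * j') / ((c - a) * (c - b)) * integral {0..pi / 2} (\<lambda>x. ?k (?q x) / 2)) (at t)"
  proof (rule cos_sin_integral_has_derivative[OF snd_less_fst_halfspace _ _ _ _ _ roots_have_derivative[OF rt dj de]])
    show "(?h has_derivative (\<lambda>(x, y). - (?k p / 2) * x + ?k p / 2 * y)) (at p)" if "p \<in> ?U" for p
      using that inverse_sqrt_diff_has_derivative[of p] by simp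
    show "continuous_on ?U (\<lambda>p. - (?k p / 2))" "continuous_on ?U (\<lambda>p. ?k p / 2)"
      by (auto intro!: continuous_intros)
  qed (use lt root_triple_y[OF rt] in auto)
  moreover have cos: "integral {0..pi / 2} (\<lambda>x. - (?k (?q x) / 2) * (cos x)\<^sup>2) = - (cos_moment a b c / 2)"
    using has_integral_neg[OF has_integral_divide[OF cos_moment_has_integral, of c a b 2]] lt
    by (intro integral_unique) simp
  moreover have sin: "integral {0..pi / 2} (\<lambda>x. - (?k (?q x) / 2) * (sin x)\<^sup>2) = - (sin_moment a b c / 2)"
    using has_integral_neg[OF has_integral_divide[OF sin_moment_has_integral, of c a b 2]] lt
    by (intro integral_unique) simp
  moreover have add: "integral {0..pi / 2} (\<lambda>x. ?k (?q x) / 2) = (cos_moment a b c + sin_moment a b c) / 2"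
    using has_integral_divide[OF moment_add_has_integral, of c a b 2] lt
    by (intro integral_unique) simp
  ultimately have "((\<lambda>\<tau>. integral {0..pi / 2} (\<lambda>x. ?h (y1 (j \<tau>) (e \<tau>) * (cos x)\<^sup>2 + y2 (j \<tau>) (e \<tau>) * (sin x)\<^sup>2, y3 (j \<tau>) (e \<tau>))))
     has_real_derivative
       ((4 * a * e' - 4 * j t * j') / ((a - b) * (a - c)) * - (cos_moment a b c / 2)
     + (4 * b * e' - 4 * j t * j') / ((b - a) * (b - c)) * - (sin_moment a b c / 2)
     + (4 * c * e' - 4 * j t * j') / ((c - a) * (c - b)) * ((cos_moment a b c + sin_moment a b c) / 2))) (at t)"
    by (simp only: cos sin add)
  from DERIV_cmult[OF this, of "2 * sqrt 2"] show ?thesis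
    unfolding T_def s_def fst_conv snd_conv
    by (rule DERIV_cong)
      (unfold moment_sum_def divide_inverse[of _ "(a - b) * (a - c)"]
        divide_inverse[of _ "(b - a) * (b - c)"] divide_inverse[of _ "(c - a) * (c - b)"],
       rule moment_sum_arith)
qed

section \<open>The phase\<close>

text \<open>The integral in \<open>Phi\<close> without its factor \<open>J\<close>: for 0 < a < b a
  complete elliptic integral of the third kind, up to a factor. It cancels from the derivatives of
  \<open>Phi\<close>.\<close>

definition inverse_moment :: "real \<Rightarrow> real \<Rightarrow> real \<Rightarrow> real" where
  "inverse_moment a b c = integral {0..pi / 2} (\<lambda>x.
     let s = a * (cos x)\<^sup>2 + b * (sin x)\<^sup>2 in 1 / (s * sqrt (s - c)))"

lemma inverse_moment_has_integral:
  assumes "0 < a" "0 < b" "c < a" "c < b"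
  shows "((\<lambda>x. 1 / ((a * (cos x)\<^sup>2 + b * (sin x)\<^sup>2) * sqrt (a * (cos x)\<^sup>2 + b * (sin x)\<^sup>2 - c)))
    has_integral inverse_moment a b c) {0..pi / 2}"
  unfolding inverse_moment_def Let_def
  using cos_sin_diff_pos[OF assms(3,4)] cos_sin_diff_pos[OF assms(1,2)]
  by (intro integrable_integral integrable_continuous_real continuous_intros)
    (auto simp: less_imp_neq[symmetric])

text \<open>The exact derivative behind the integration by parts, in two forms: the first is
  arranged for the weight \<open>(cos x)\<^sup>2\<close> of \<open>a\<close>, the second for the
  weight \<open>(sin x)\<^sup>2\<close> of \<open>b\<close>.\<close>

lemma sin_cos_ratio_has_derivative:
  fixes a b c x :: real
  defines "S \<equiv> \<lambda>x. a * (cos x)\<^sup>2 + b * (sin x)\<^sup>2"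
  assumes pos: "0 < a" "0 < b" "c < a" "c < b"
  shows "((\<lambda>x. sin x * cos x / (S x * sqrt (S x - c))) has_real_derivative
      (2 * a * (cos x)\<^sup>2 / ((S x)\<^sup>2 * sqrt (S x - c)) + a * (cos x)\<^sup>2 / (S x * ((S x - c) * sqrt (S x - c)))
      - 1 / (S x * sqrt (S x - c)) - (cos x)\<^sup>2 / ((S x - c) * sqrt (S x - c)))) (at x)" (is ?cos)
    and "((\<lambda>x. - (sin x * cos x / (S x * sqrt (S x - c)))) has_real_derivative
      (2 * b * (sin x)\<^sup>2 / ((S x)\<^sup>2 * sqrt (S x - c)) + b * (sin x)\<^sup>2 / (S x * ((S x - c) * sqrt (S x - c)))
      - 1 / (S x * sqrt (S x - c)) - (sin x)\<^sup>2 / ((S x - c) * sqrt (S x - c)))) (at x)" (is ?sin)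
proof -
  have s: "0 < S x" and \<sigma>: "0 < S x - c"
    using cos_sin_diff_pos[OF pos(3,4)] cos_sin_diff_pos[OF pos(1,2)] by (auto simp: S_def)
  let ?s' = "2 * (b - a) * (sin x * cos x)"
  have ds: "(S has_real_derivative ?s') (at x)"
    unfolding S_def by (auto intro!: derivative_eq_intros simp: algebra_simps)
  have d1: "((\<lambda>x. sin x * cos x) has_real_derivative (cos x)\<^sup>2 - (sin x)\<^sup>2) (at x)"
    by (auto intro!: derivative_eq_intros simp: power2_eq_square)
  have d2: "((\<lambda>x. 1 / S x) has_real_derivative - ?s' / (S x)\<^sup>2) (at x)"
    using DERIV_divide[OF DERIV_const[of 1] ds] s by (simp add: power2_eq_square)
  have "((\<lambda>x. S x - c) has_real_derivative ?s') (at x)"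
    using DERIV_diff[OF ds DERIV_const[of c]] by simp
  from DERIV_chain2[OF inverse_sqrt_has_derivative[OF \<sigma>] this]
  have d3: "((\<lambda>x. 1 / sqrt (S x - c)) has_real_derivative
      - (1 / ((S x - c) * sqrt (S x - c)) / 2) * ?s') (at x)" .
  \<comment> \<open>With the four reciprocals as unknowns, only K1 = S K2 and K4 = S K3 are used,
    and the claims become polynomial identities modulo cos^2 + sin^2 = 1.\<close>
  define K1 K2 K3 K4 where
    "K1 = 1 / (S x * sqrt (S x - c))" and "K2 = 1 / ((S x)\<^sup>2 * sqrt (S x - c))" and
    "K3 = 1 / (S x * ((S x - c) * sqrt (S x - c)))" and "K4 = 1 / ((S x - c) * sqrt (S x - c))"
  have K: "K1 = S x * K2" "K4 = S x * K3"
    using s by (simp_all add: K1_def K2_def K3_def K4_def power2_eq_square)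
  have cs: "(cos x)\<^sup>2 + (sin x)\<^sup>2 = 1"
    by simp
  have "((\<lambda>x. sin x * cos x * (1 / S x) * (1 / sqrt (S x - c))) has_real_derivative
      ((cos x)\<^sup>2 - (sin x)\<^sup>2) * K1 - 2 * ((b - a) * (sin x)\<^sup>2 * (cos x)\<^sup>2) * K2
        - (b - a) * (sin x)\<^sup>2 * (cos x)\<^sup>2 * K3) (at x)"
  proof (rule DERIV_cong[OF DERIV_mult[OF DERIV_mult[OF d1 d2] d3]])
    have "(d * (1 / s) + - (2 * k * (u * v)) / s\<^sup>2 * (u * v)) * (1 / r)
        + - (1 / (\<rho> * r) / 2) * (2 * k * (u * v)) * (u * v * (1 / s))
      = d * (1 / (s * r)) - 2 * (k * u\<^sup>2 * v\<^sup>2) * (1 / (s\<^sup>2 * r)) - k * u\<^sup>2 * v\<^sup>2 * (1 / (s * (\<rho> * r)))"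
      for d k u v s r \<rho> :: real
    proof -
      have "(d * A + - (2 * k * (u * v)) * B * (u * v)) * R + - (C / 2) * (2 * k * (u * v)) * (u * v * A)
        = d * (A * R) - 2 * (k * u\<^sup>2 * v\<^sup>2) * (B * R) - k * u\<^sup>2 * v\<^sup>2 * (A * C)" for A B C R
        by (simp add: field_simps power2_eq_square)
      from this[of "1 / s" "1 / s\<^sup>2" "1 / r" "1 / (\<rho> * r)"] show ?thesis
        by simp
    qed
    then show "(((cos x)\<^sup>2 - (sin x)\<^sup>2) * (1 / S x) + - ?s' / (S x)\<^sup>2 * (sin x * cos x)) * (1 / sqrt (S x - c))
        + - (1 / ((S x - c) * sqrt (S x - c)) / 2) * ?s' * (sin x * cos x * (1 / S x))
      = ((cos x)\<^sup>2 - (sin x)\<^sup>2) * K1 - 2 * ((b - a) * (sin x)\<^sup>2 * (cos x)\<^sup>2) * K2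
        - (b - a) * (sin x)\<^sup>2 * (cos x)\<^sup>2 * K3"
      unfolding K1_def K2_def K3_def by blast
  qed
  then have D: "((\<lambda>x. sin x * cos x / (S x * sqrt (S x - c))) has_real_derivative
      ((cos x)\<^sup>2 - (sin x)\<^sup>2) * K1 - 2 * ((b - a) * (sin x)\<^sup>2 * (cos x)\<^sup>2) * K2
        - (b - a) * (sin x)\<^sup>2 * (cos x)\<^sup>2 * K3) (at x)"
    by simp
  have sx: "S x = a * (cos x)\<^sup>2 + b * (sin x)\<^sup>2"
    by (simp add: S_def)
  have "((cos x)\<^sup>2 - (sin x)\<^sup>2) * K1 - 2 * ((b - a) * (sin x)\<^sup>2 * (cos x)\<^sup>2) * K2
        - (b - a) * (sin x)\<^sup>2 * (cos x)\<^sup>2 * K3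
      = 2 * (a * (cos x)\<^sup>2 * K2) + a * (cos x)\<^sup>2 * K3 - K1 - (cos x)\<^sup>2 * K4"
    using K sx cs by algebra
  with D have "((\<lambda>x. sin x * cos x / (S x * sqrt (S x - c))) has_real_derivative
      2 * (a * (cos x)\<^sup>2 * K2) + a * (cos x)\<^sup>2 * K3 - K1 - (cos x)\<^sup>2 * K4) (at x)"
    by simp
  then show ?cos
    by (simp add: K1_def K2_def K3_def K4_def mult.assoc)
  have "- (((cos x)\<^sup>2 - (sin x)\<^sup>2) * K1 - 2 * ((b - a) * (sin x)\<^sup>2 * (cos x)\<^sup>2) * K2
        - (b - a) * (sin x)\<^sup>2 * (cos x)\<^sup>2 * K3)
      = 2 * (b * (sin x)\<^sup>2 * K2) + b * (sin x)\<^sup>2 * K3 - K1 - (sin x)\<^sup>2 * K4"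
    using K sx cs by algebra
  with DERIV_minus[OF D] have "((\<lambda>x. - (sin x * cos x / (S x * sqrt (S x - c)))) has_real_derivative
      2 * (b * (sin x)\<^sup>2 * K2) + b * (sin x)\<^sup>2 * K3 - K1 - (sin x)\<^sup>2 * K4) (at x)"
    by simp
  then show ?sin
    by (simp add: K1_def K2_def K3_def K4_def mult.assoc)
qed

text \<open>The integrands of the two sides differ by half the derivative of
  \<open>sin * cos / (s * sqrt (s - c))\<close>, up to sign, which vanishes at both endpoints.\<close>

lemma inverse_moment_partials:
  fixes a b c :: real
  defines "S \<equiv> \<lambda>x. a * (cos x)\<^sup>2 + b * (sin x)\<^sup>2"
  assumes pos: "0 < a" "0 < b" "c < a" "c < b"
  shows "a * integral {0..pi / 2} (\<lambda>x. - (1 / ((S x)\<^sup>2 * sqrt (S x - c)) +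
        1 / (S x * ((S x - c) * sqrt (S x - c))) / 2) * (cos x)\<^sup>2)
      = - ((cos_moment a b c + inverse_moment a b c) / 2)" (is ?cos)
    and "b * integral {0..pi / 2} (\<lambda>x. - (1 / ((S x)\<^sup>2 * sqrt (S x - c)) +
        1 / (S x * ((S x - c) * sqrt (S x - c))) / 2) * (sin x)\<^sup>2)
      = - ((sin_moment a b c + inverse_moment a b c) / 2)" (is ?sin)
    and "c * integral {0..pi / 2} (\<lambda>x. 1 / (S x * ((S x - c) * sqrt (S x - c))) / 2)
      = (cos_moment a b c + sin_moment a b c - inverse_moment a b c) / 2" (is ?c)
proof -
  have p: "0 < S x" "0 < S x - c" for x
    using cos_sin_diff_pos[OF pos(3,4)] cos_sin_diff_pos[OF pos(1,2)] by (auto simp: S_def)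
  have S_eq: "a * (cos x)\<^sup>2 + b * (sin x)\<^sup>2 = S x" for x
    by (simp add: S_def)
  note ints = cos_moment_has_integral[OF pos(3,4), unfolded S_eq]
    sin_moment_has_integral[OF pos(3,4), unfolded S_eq]
    moment_add_has_integral[OF pos(3,4), unfolded S_eq]
    inverse_moment_has_integral[OF pos, unfolded S_eq]
  note derivs = sin_cos_ratio_has_derivative[OF pos, unfolded S_eq]
  have pointwise: "- ((v / z + 1 / w) / 2) - (2 * k * v / x + k * v / y - 1 / w - v / z) / 2
      = k * (- (1 / x + 1 / y / 2) * v)" for k v w x y z :: real
  proof -
    have "- ((v * Z + W) / 2) - (2 * k * v * X + k * v * Y - W - v * Z) / 2 = k * (- (X + Y / 2) * v)"
      for W X Y Z by (simp add: field_simps)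
    from this[of "1 / z" "1 / w" "1 / x" "1 / y"] show ?thesis
      by simp
  qed
  have "((\<lambda>x. - (((cos x)\<^sup>2 / ((S x - c) * sqrt (S x - c)) + 1 / (S x * sqrt (S x - c))) / 2)
      - (2 * a * (cos x)\<^sup>2 / ((S x)\<^sup>2 * sqrt (S x - c)) + a * (cos x)\<^sup>2 / (S x * ((S x - c) * sqrt (S x - c)))
      - 1 / (S x * sqrt (S x - c)) - (cos x)\<^sup>2 / ((S x - c) * sqrt (S x - c))) / 2)
    has_integral - ((cos_moment a b c + inverse_moment a b c) / 2) - 0 / 2) {0..pi / 2}"
    using has_integral_of_derivative[OF _ derivs(1), of 0 "pi / 2"]
    by (intro has_integral_diff has_integral_neg has_integral_divide has_integral_add ints) auto
  also have "(\<lambda>x. - (((cos x)\<^sup>2 / ((S x - c) * sqrt (S x - c)) + 1 / (S x * sqrt (S x - c))) / 2)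
      - (2 * a * (cos x)\<^sup>2 / ((S x)\<^sup>2 * sqrt (S x - c)) + a * (cos x)\<^sup>2 / (S x * ((S x - c) * sqrt (S x - c)))
      - 1 / (S x * sqrt (S x - c)) - (cos x)\<^sup>2 / ((S x - c) * sqrt (S x - c))) / 2)
    = (\<lambda>x. a * (- (1 / ((S x)\<^sup>2 * sqrt (S x - c)) +
        1 / (S x * ((S x - c) * sqrt (S x - c))) / 2) * (cos x)\<^sup>2))"
    using pointwise by (intro ext)
  finally show ?cos
    unfolding integral_mult_right[symmetric] by (intro integral_unique) simp
  have "((\<lambda>x. - (((sin x)\<^sup>2 / ((S x - c) * sqrt (S x - c)) + 1 / (S x * sqrt (S x - c))) / 2)
      - (2 * b * (sin x)\<^sup>2 / ((S x)\<^sup>2 * sqrt (S x - c)) + b * (sin x)\<^sup>2 / (S x * ((S x - c) * sqrt (S x - c)))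
      - 1 / (S x * sqrt (S x - c)) - (sin x)\<^sup>2 / ((S x - c) * sqrt (S x - c))) / 2)
    has_integral - ((sin_moment a b c + inverse_moment a b c) / 2) - 0 / 2) {0..pi / 2}"
    using has_integral_of_derivative[OF _ derivs(2), of 0 "pi / 2"]
    by (intro has_integral_diff has_integral_neg has_integral_divide has_integral_add ints) auto
  also have "(\<lambda>x. - (((sin x)\<^sup>2 / ((S x - c) * sqrt (S x - c)) + 1 / (S x * sqrt (S x - c))) / 2)
      - (2 * b * (sin x)\<^sup>2 / ((S x)\<^sup>2 * sqrt (S x - c)) + b * (sin x)\<^sup>2 / (S x * ((S x - c) * sqrt (S x - c)))
      - 1 / (S x * sqrt (S x - c)) - (sin x)\<^sup>2 / ((S x - c) * sqrt (S x - c))) / 2)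
    = (\<lambda>x. b * (- (1 / ((S x)\<^sup>2 * sqrt (S x - c)) +
        1 / (S x * ((S x - c) * sqrt (S x - c))) / 2) * (sin x)\<^sup>2))"
    using pointwise by (intro ext)
  finally show ?sin
    unfolding integral_mult_right[symmetric] by (intro integral_unique) simp
  \<comment> \<open>Here no integration by parts is needed: writing \<open>c\<close> as S - (S - c)
    splits the integrand.\<close>
  have "((\<lambda>x. (1 / ((S x - c) * sqrt (S x - c)) - 1 / (S x * sqrt (S x - c))) / 2)
    has_integral (cos_moment a b c + sin_moment a b c - inverse_moment a b c) / 2) {0..pi / 2}"
    by (intro has_integral_diff has_integral_divide ints)
  also have "(\<lambda>x. (1 / ((S x - c) * sqrt (S x - c)) - 1 / (S x * sqrt (S x - c))) / 2)
    = (\<lambda>x. c * (1 / (S x * ((S x - c) * sqrt (S x - c))) / 2))"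
  proof
    fix x
    have "1 / (\<sigma> * r) - 1 / (s * r) = c * (1 / (s * (\<sigma> * r)))"
      if "0 < s" "0 < \<sigma>" "0 < r" "c = s - \<sigma>" for s \<sigma> r :: real
      using that by (simp add: field_simps)
    from this[of "S x" "S x - c" "sqrt (S x - c)"] p[of x]
    show "(1 / ((S x - c) * sqrt (S x - c)) - 1 / (S x * sqrt (S x - c))) / 2
      = c * (1 / (S x * ((S x - c) * sqrt (S x - c))) / 2)"
      by simp
  qed
  finally show ?c
    unfolding integral_mult_right[symmetric] by (intro integral_unique)
qed

lemma inverse_integrand_has_derivative:
  fixes p :: "real \<times> real"
  assumes "0 < fst p" "snd p < fst p"
  shows "((\<lambda>p. 1 / (fst p * sqrt (fst p - snd p))) has_derivative
    (\<lambda>(x, y). - (1 / ((fst p)\<^sup>2 * sqrt (fst p - snd p)) +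
        1 / (fst p * ((fst p - snd p) * sqrt (fst p - snd p))) / 2) * x
      + 1 / (fst p * ((fst p - snd p) * sqrt (fst p - snd p))) / 2 * y)) (at p)"
proof -
  have "((\<lambda>p. 1 / fst p) has_derivative (\<lambda>q. - fst q / (fst p)\<^sup>2)) (at p)"
    using assms by (auto intro!: derivative_eq_intros simp: power2_eq_square)
  from has_derivative_mult[OF this inverse_sqrt_diff_has_derivative[OF assms(2)]]
  have "((\<lambda>p. 1 / (fst p * sqrt (fst p - snd p))) has_derivative
    (\<lambda>h. 1 / fst p * (case h of (x, y) \<Rightarrow> - (1 / ((fst p - snd p) * sqrt (fst p - snd p)) / 2) * x
      + 1 / ((fst p - snd p) * sqrt (fst p - snd p)) / 2 * y)
      + - fst h / (fst p)\<^sup>2 * (1 / sqrt (fst p - snd p)))) (at p)"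
    by simp
  then show ?thesis
  proof (rule has_derivative_eq_rhs)
    have "1 / s * (- (1 / \<rho> / 2) * x + 1 / \<rho> / 2 * y) + - x / s\<^sup>2 * (1 / r)
      = - (1 / (s\<^sup>2 * r) + 1 / (s * \<rho>) / 2) * x + 1 / (s * \<rho>) / 2 * y" for s \<rho> r x y :: real
      by (simp add: algebra_simps)
    then show "(\<lambda>h. 1 / fst p * (case h of (x, y) \<Rightarrow> - (1 / ((fst p - snd p) * sqrt (fst p - snd p)) / 2) * x
      + 1 / ((fst p - snd p) * sqrt (fst p - snd p)) / 2 * y)
      + - fst h / (fst p)\<^sup>2 * (1 / sqrt (fst p - snd p)))
     = (\<lambda>(x, y). - (1 / ((fst p)\<^sup>2 * sqrt (fst p - snd p)) +
        1 / (fst p * ((fst p - snd p) * sqrt (fst p - snd p))) / 2) * x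
      + 1 / (fst p * ((fst p - snd p) * sqrt (fst p - snd p))) / 2 * y)"
      unfolding fun_eq_iff case_prod_unfold by blast
  qed
qed

text \<open>Why the elliptic integral \<open>I\<close> of the third kind disappears. Replacing
  \<open>2 * j\<^sup>2\<close> by \<open>- (a * b * c)\<close> supplies the factors a, b, c that the
  known values of a A, b B, c C require. The coefficient of \<open>I\<close> in the root terms is
  then - d by the two identities for u, v, w, which cancels the term from differentiating the factor
  \<open>j\<close>.\<close>

lemma Phi_arith:
  fixes a b c :: real
  assumes "a * A = - ((X + I) / 2)" "b * B = - ((Y + I) / 2)" "c * C = (X + Y - I) / 2"
    and "a * b * c = - 2 * j\<^sup>2" "u + v + w = 0" "b * c * u + c * a * v + a * b * w = 1"
  shows "2 * k * (d * I + ((4 * a * e - 4 * j * d) * u * A + (4 * b * e - 4 * j * d) * v * B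
        + (4 * c * e - 4 * j * d) * w * C) * j)
      = 4 * k * j * e * (- (1 * X) * u - 1 * Y * v + 1 * (X + Y) * w)
        + 2 * k * d * (- (b * c * X) * u - c * a * Y * v + a * b * (X + Y) * w)"
proof -
  have "(4 * a * e - 4 * j * d) * u * A * j = (4 * j * e + 2 * d * (b * c)) * u * (a * A)"
    "(4 * b * e - 4 * j * d) * v * B * j = (4 * j * e + 2 * d * (c * a)) * v * (b * B)"
    "(4 * c * e - 4 * j * d) * w * C * j = (4 * j * e + 2 * d * (a * b)) * w * (c * C)"
    using assms(4) by algebra+
  then have "((4 * a * e - 4 * j * d) * u * A + (4 * b * e - 4 * j * d) * v * B
        + (4 * c * e - 4 * j * d) * w * C) * j
    = (4 * j * e + 2 * d * (b * c)) * u * - ((X + I) / 2) + (4 * j * e + 2 * d * (c * a)) * v * - ((Y + I) / 2)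
      + (4 * j * e + 2 * d * (a * b)) * w * ((X + Y - I) / 2)"
    unfolding assms(1-3)[symmetric] by (simp add: distrib_right)
  also have "\<dots> = 2 * j * e * (- (1 * X) * u - 1 * Y * v + 1 * (X + Y) * w)
      + d * (- (b * c * X) * u - c * a * Y * v + a * b * (X + Y) * w)
      - I * (2 * j * e * (u + v + w) + d * (b * c * u + c * a * v + a * b * w))"
    by (simp add: field_simps)
  finally show ?thesis
    unfolding assms(5,6) by (simp only:) (simp add: algebra_simps)
qed

text \<open>All three reciprocals become polynomials in the roots and a single \<open>D\<close>,
  subject to one relation, so later identities can be decided by polynomial algebra.\<close>

lemma vandermonde_inverse:
  fixes a b c :: real
  assumes "c < a" "a < b"
  obtains D where "(a - b) * (a - c) * (b - c) * D = 1"
    "inverse ((a - b) * (a - c)) = (b - c) * D" "inverse ((b - a) * (b - c)) = - (a - c) * D"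
    "inverse ((c - a) * (c - b)) = (a - b) * D"
proof
  have ne: "a - b \<noteq> 0" "a - c \<noteq> 0" "b - c \<noteq> 0"
    using assms by auto
  let ?D = "inverse ((a - b) * (a - c) * (b - c))"
  show "inverse ((a - b) * (a - c)) = (b - c) * ?D" "inverse ((b - a) * (b - c)) = - (a - c) * ?D"
    "inverse ((c - a) * (c - b)) = (a - b) * ?D"
    using ne by (simp_all add: divide_simps) (simp_all add: algebra_simps)
  show "(a - b) * (a - c) * (b - c) * ?D = 1"
    using ne by (simp del: inverse_mult_distrib)
qed

lemma Phi_eq_inverse_moment: "Phi J E = 2 * sqrt 2 * (J * inverse_moment (y1 J E) (y2 J E) (y3 J E))"
proof -
  have "integral A (\<lambda>x. J / f x * (1 / g x)) = J * integral A (\<lambda>x. 1 / (f x * g x))"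
    for A and f g :: "real \<Rightarrow> real"
    using integral_mult_right[of A J "\<lambda>x. 1 / (f x * g x)"] by simp
  then show ?thesis
    unfolding Phi_def s_def inverse_moment_def Let_def by (simp only:)
qed

text \<open>The coefficient of \<open>e'\<close> is the negative of the coefficient of
  \<open>j'\<close> in \<open>T_has_derivative\<close>: the form T dE - Phi dJ is closed.\<close>

lemma Phi_has_derivative:
  assumes rt: "root_triple (j t) (e t) a b c" and a: "0 < a"
    and dj: "(j has_real_derivative j') (at t)" and de: "(e has_real_derivative e') (at t)"
  shows "((\<lambda>\<tau>. Phi (j \<tau>) (e \<tau>)) has_real_derivative
    4 * sqrt 2 * j t * e' * moment_sum a b c 1 1 1
      + 2 * sqrt 2 * j' * moment_sum a b c (b * c) (c * a) (a * b)) (at t)"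
proof -
  note lt = root_triple_less[OF rt]
  have pos: "0 < a" "0 < b" "c < a" "c < b"
    using lt a by auto
  let ?U = "{p::real \<times> real. 0 < fst p} \<inter> {p. snd p < fst p}"
  have half: "{p::real \<times> real. 0 < fst p} = {x. (-1, 0) \<bullet> x < 0}"
    by (auto simp: inner_prod_def)
  have U: "convex ?U" "open ?U"
    unfolding half
    by (auto intro!: convex_Int open_Int snd_less_fst_halfspace convex_halfspace_lt open_halfspace_lt)
  let ?h = "\<lambda>p::real \<times> real. 1 / (fst p * sqrt (fst p - snd p))"
  let ?h1 = "\<lambda>p::real \<times> real. - (1 / ((fst p)\<^sup>2 * sqrt (fst p - snd p)) +
        1 / (fst p * ((fst p - snd p) * sqrt (fst p - snd p))) / 2)"
  let ?h2 = "\<lambda>p::real \<times> real. 1 / (fst p * ((fst p - snd p) * sqrt (fst p - snd p))) / 2"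
  let ?q = "\<lambda>x. (a * (cos x)\<^sup>2 + b * (sin x)\<^sup>2, c)"
  let ?I = "\<lambda>\<tau>. integral {0..pi / 2} (\<lambda>x. ?h (y1 (j \<tau>) (e \<tau>) * (cos x)\<^sup>2 + y2 (j \<tau>) (e \<tau>) * (sin x)\<^sup>2, y3 (j \<tau>) (e \<tau>)))"
  have "(?I has_real_derivative
       (4 * a * e' - 4 * j t * j') / ((a - b) * (a - c)) * integral {0..pi / 2} (\<lambda>x. ?h1 (?q x) * (cos x)\<^sup>2)
     + (4 * b * e' - 4 * j t * j') / ((b - a) * (b - c)) * integral {0..pi / 2} (\<lambda>x. ?h1 (?q x) * (sin x)\<^sup>2)
     + (4 * c * e' - 4 * j t * j') / ((c - a) * (c - b)) * integral {0..pi / 2} (\<lambda>x. ?h2 (?q x))) (at t)"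
  proof (rule cos_sin_integral_has_derivative[OF U _ _ _ _ _ roots_have_derivative[OF rt dj de]])
    show "(?h has_derivative (\<lambda>(x, y). ?h1 p * x + ?h2 p * y)) (at p)" if "p \<in> ?U" for p
      using that inverse_integrand_has_derivative[of p] by simp
    show "continuous_on ?U ?h1" "continuous_on ?U ?h2"
      by (auto intro!: continuous_intros)
  qed (use pos root_triple_y[OF rt] in auto)
  from DERIV_cmult[OF DERIV_mult[OF dj this], of "2 * sqrt 2"]
  have deriv: "((\<lambda>\<tau>. 2 * sqrt 2 * (j \<tau> * ?I \<tau>)) has_real_derivative 2 * sqrt 2 * (j' * ?I t +
      ((4 * a * e' - 4 * j t * j') / ((a - b) * (a - c)) * integral {0..pi / 2} (\<lambda>x. ?h1 (?q x) * (cos x)\<^sup>2)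
     + (4 * b * e' - 4 * j t * j') / ((b - a) * (b - c)) * integral {0..pi / 2} (\<lambda>x. ?h1 (?q x) * (sin x)\<^sup>2)
     + (4 * c * e' - 4 * j t * j') / ((c - a) * (c - b)) * integral {0..pi / 2} (\<lambda>x. ?h2 (?q x))) * j t)) (at t)" .
  have It: "?I t = inverse_moment a b c"
    by (simp add: inverse_moment_def Let_def root_triple_y[OF rt])
  obtain D where D1: "(a - b) * (a - c) * (b - c) * D = 1" and
    inv: "inverse ((a - b) * (a - c)) = (b - c) * D" "inverse ((b - a) * (b - c)) = - (a - c) * D"
      "inverse ((c - a) * (c - b)) = (a - b) * D"
    using vandermonde_inverse lt by blast
  \<comment> \<open>Lagrange interpolation of the constant 1 at the three roots: \<open>sum0\<close>
    is its quadratic coefficient, \<open>sum1\<close> its value at 0.\<close>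
  have sum0: "inverse ((a - b) * (a - c)) + inverse ((b - a) * (b - c)) + inverse ((c - a) * (c - b)) = 0"
    unfolding inv by (simp add: algebra_simps)
  have sum1: "b * c * inverse ((a - b) * (a - c)) + c * a * inverse ((b - a) * (b - c))
      + a * b * inverse ((c - a) * (c - b)) = 1"
    using D1 unfolding inv by algebra
  note deriv' = deriv[unfolded fst_conv snd_conv, unfolded It[unfolded fst_conv snd_conv]]
  have abc: "a * b * c = - 2 * (j t)\<^sup>2"
    using rt by (simp add: root_triple_def)
  note arith = Phi_arith[OF inverse_moment_partials[OF pos] abc sum0 sum1, of "sqrt 2" j' e']
  show ?thesis
    unfolding Phi_eq_inverse_moment inverse_moment_def Let_def
    by (rule DERIV_cong[OF deriv'])
      (unfold moment_sum_def divide_inverse[of _ "(a - b) * (a - c)"]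
        divide_inverse[of _ "(b - a) * (b - c)"] divide_inverse[of _ "(c - a) * (c - b)"],
       rule arith)
qed

section \<open>The renormalized phase\<close>

text \<open>The usual primitive arctan((\<beta> / \<alpha>) tan x) breaks down at pi / 2. Splitting
  off x leaves arctan(N / D), smooth everywhere, because D + iN is exp(- ix) times \<alpha> cos x +
  i \<beta> sin x.\<close>

lemma cos_sin_reciprocal_has_integral:
  fixes a b :: real
  assumes ab: "0 < a" "0 < b"
  shows "((\<lambda>x. 1 / (a * (cos x)\<^sup>2 + b * (sin x)\<^sup>2)) has_integral pi / 2 / sqrt (a * b)) {0..pi / 2}"
proof -
  define \<alpha> \<beta> where "\<alpha> = sqrt a" and "\<beta> = sqrt b"
  have pos: "0 < \<alpha>" "0 < \<beta>" and sq: "a = \<alpha>\<^sup>2" "b = \<beta>\<^sup>2"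
    using ab by (auto simp: \<alpha>_def \<beta>_def)
  define N D where "N x = (\<beta> - \<alpha>) * (sin x * cos x)" and "D x = \<alpha> * (cos x)\<^sup>2 + \<beta> * (sin x)\<^sup>2"
    for x :: real
  let ?s = "\<lambda>x. a * (cos x)\<^sup>2 + b * (sin x)\<^sup>2"
  have "((\<lambda>x. (x + arctan (N x / D x)) / (\<alpha> * \<beta>)) has_real_derivative 1 / ?s x) (at x)" for x
  proof -
    have Dpos: "0 < D x" and spos: "0 < ?s x"
      using cos_sin_diff_pos[of 0 \<alpha> \<beta> x] cos_sin_diff_pos[of 0 a b x] pos ab by (auto simp: D_def)
    let ?N' = "(\<beta> - \<alpha>) * ((cos x)\<^sup>2 - (sin x)\<^sup>2)" and ?D' = "2 * (\<beta> - \<alpha>) * (sin x * cos x)"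
    have "(N has_real_derivative ?N') (at x)"
      unfolding N_def by (auto intro!: derivative_eq_intros simp: power2_eq_square)
    moreover have "(D has_real_derivative ?D') (at x)"
      unfolding D_def by (auto intro!: derivative_eq_intros simp: algebra_simps)
    ultimately have "((\<lambda>x. N x / D x) has_real_derivative (?N' * D x - N x * ?D') / (D x * D x)) (at x)"
      using Dpos by (intro DERIV_divide) auto
    from DERIV_cdivide[OF DERIV_add[OF DERIV_ident DERIV_chain2[OF DERIV_arctan this]], of "\<alpha> * \<beta>"]
    show ?thesis
    proof (rule DERIV_cong)
      have cs: "(cos x)\<^sup>2 + (sin x)\<^sup>2 = 1"
        by simp
      have sum: "(D x)\<^sup>2 + (N x)\<^sup>2 = ?s x" "?s x + (?N' * D x - N x * ?D') = \<alpha> * \<beta>"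
        using cs unfolding D_def N_def sq by algebra+
      have "inverse (1 + (N x / D x)\<^sup>2) * ((?N' * D x - N x * ?D') / (D x * D x))
          = (?N' * D x - N x * ?D') / ((D x)\<^sup>2 + (N x)\<^sup>2)"
        using Dpos by (simp add: divide_simps power2_eq_square)
      then have "(1 + inverse (1 + (N x / D x)\<^sup>2) * ((?N' * D x - N x * ?D') / (D x * D x))) / (\<alpha> * \<beta>)
          = (?s x + (?N' * D x - N x * ?D')) / ?s x / (\<alpha> * \<beta>)"
        unfolding sum(1) using spos by (simp add: add_divide_distrib)
      also have "\<dots> = 1 / ?s x"
        unfolding sum(2) using pos by simp
      finally show "(1 + inverse (1 + (N x / D x)\<^sup>2) * ((?N' * D x - N x * ?D') / (D x * D x))) / (\<alpha> * \<beta>)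
          = 1 / ?s x" .
    qed
  qed
  from has_integral_of_derivative[OF _ this, of 0 "pi / 2"] show ?thesis
    by (simp add: N_def \<alpha>_def \<beta>_def real_sqrt_mult)
qed

text \<open>A function of the pair (s, c), to fit the integral lemmas above. It stays continuous at
  s = 0 as long as c < 0, which covers \<open>Gamma_plus\<close>.\<close>

definition renormalized_integrand :: "real \<times> real \<Rightarrow> real" where
  "renormalized_integrand = (\<lambda>(s, c). 1 / (sqrt (- c) * sqrt (s - c) * (sqrt (- c) + sqrt (s - c))))"

lemma continuous_renormalized_integrand:
  "continuous_on {p. snd p < 0 \<and> snd p < fst p} renormalized_integrand"
  unfolding renormalized_integrand_def case_prod_unfold
  by (intro continuous_intros) (auto simp: add_pos_pos less_imp_neq[symmetric])

lemma convex_open_renormalized_domain: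
  "convex {p::real \<times> real. snd p < 0 \<and> snd p < fst p}"
  "open {p::real \<times> real. snd p < 0 \<and> snd p < fst p}"
proof -
  have "{p::real \<times> real. snd p < 0 \<and> snd p < fst p} = {x. (0, 1) \<bullet> x < 0} \<inter> {p. snd p < fst p}"
    by (auto simp: inner_prod_def)
  then show "convex {p::real \<times> real. snd p < 0 \<and> snd p < fst p}"
    "open {p::real \<times> real. snd p < 0 \<and> snd p < fst p}"
    by (auto intro!: convex_Int open_Int snd_less_fst_halfspace convex_halfspace_lt open_halfspace_lt)
qed

lemma Psi_eq_renormalized:
  "Psi J E = - (2 * sqrt 2) * (J * integral {0..pi / 2} (\<lambda>x. renormalized_integrand
     (y1 J E * (cos x)\<^sup>2 + y2 J E * (sin x)\<^sup>2, y3 J E)))"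
  by (simp add: Psi_def s_def renormalized_integrand_def)

text \<open>Writing \<open>s = \<sigma> - w\<^sup>2\<close> with \<open>w\<^sup>2 = - c\<close>, the integrands of \<open>Phi\<close> and \<open>- Psi\<close>, without the
  common factor \<open>J\<close>, add up to \<open>1 / (w * s)\<close>.\<close>

lemma Psi_eq_Phi:
  assumes rt: "root_triple J E a b c" and J: "J \<noteq> 0"
  shows "Psi J E = Phi J E - pi * sgn J"
proof -
  note lt = root_triple_less[OF rt] and sign = root_triple_sign[OF rt]
  have J2: "2 * J\<^sup>2 = a * b * - c"
    using rt by (simp add: root_triple_def)
  then have "a \<noteq> 0" "c \<noteq> 0"
    using J by auto
  then have pos: "0 < a" "0 < b" "c < 0" "c < a" "c < b"
    using lt sign by auto
  let ?s = "\<lambda>x. a * (cos x)\<^sup>2 + b * (sin x)\<^sup>2"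
  let ?K = "integral {0..pi / 2} (\<lambda>x. renormalized_integrand (?s x, c))"
  have "continuous_on {0..pi / 2} (\<lambda>x. renormalized_integrand (?s x, c))"
    using pos by (intro continuous_cos_sin_integrand[OF convex_open_renormalized_domain(1)
      continuous_renormalized_integrand]) auto
  then have "((\<lambda>x. renormalized_integrand (?s x, c)) has_integral ?K) {0..pi / 2}"
    by (intro integrable_integral integrable_continuous_real)
  then have "((\<lambda>x. 1 / (?s x * sqrt (?s x - c)) + renormalized_integrand (?s x, c))
      has_integral inverse_moment a b c + ?K) {0..pi / 2}"
    by (intro has_integral_add inverse_moment_has_integral pos)
  moreover have "1 / (?s x * sqrt (?s x - c)) + renormalized_integrand (?s x, c)
      = 1 / sqrt (- c) * (1 / ?s x)" for x
  proof -
    have eq: "1 / (s * r) + 1 / (w * r * (w + r)) = 1 / w * (1 / s)"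
      if "0 < w" "w < r" "s = (r - w) * (w + r)" for w r s :: real
      using that by (simp add: divide_simps)
    have "?s x = (sqrt (?s x - c) - sqrt (- c)) * (sqrt (- c) + sqrt (?s x - c))"
      using cos_sin_diff_pos[of c a b x] pos by (simp add: algebra_simps)
    moreover have "sqrt (- c) < sqrt (?s x - c)"
      using cos_sin_diff_pos[of 0 a b x] pos by simp
    ultimately show ?thesis
      using eq[of "sqrt (- c)" "sqrt (?s x - c)" "?s x"] pos
      by (simp only: renormalized_integrand_def case_prod_conv) simp
  qed
  ultimately have "((\<lambda>x. 1 / sqrt (- c) * (1 / ?s x)) has_integral inverse_moment a b c + ?K) {0..pi / 2}"
    by simp
  moreover have "((\<lambda>x. 1 / sqrt (- c) * (1 / ?s x)) has_integral 1 / sqrt (- c) * (pi / 2 / sqrt (a * b))) {0..pi / 2}"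
    using cos_sin_reciprocal_has_integral[OF pos(1,2)] by (rule has_integral_mult_right)
  ultimately have "inverse_moment a b c + ?K = 1 / sqrt (- c) * (pi / 2 / sqrt (a * b))"
    by (rule has_integral_unique)
  \<comment> \<open>The product of the roots turns the constant into a function of \<open>J\<close>
    alone; the prefactor \<open>2 * sqrt 2 * J\<close> then leaves pi times the sign of
    \<open>J\<close>.\<close>
  also have "\<dots> = pi / 2 / sqrt (2 * J\<^sup>2)"
    unfolding J2 real_sqrt_mult by simp
  also have "sqrt (2 * J\<^sup>2) = sqrt 2 * \<bar>J\<bar>"
    by (simp add: real_sqrt_mult)
  finally have K: "inverse_moment a b c + ?K = pi / 2 / (sqrt 2 * \<bar>J\<bar>)" .
  have "Phi J E - Psi J E = 2 * sqrt 2 * (J * (inverse_moment a b c + ?K))"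
    unfolding Phi_eq_inverse_moment Psi_eq_renormalized root_triple_y[OF rt]
    by (simp add: algebra_simps)
  also have "\<dots> = pi * sgn J"
    unfolding K using J by (simp add: sgn_if field_simps)
  finally show ?thesis
    by simp
qed

text \<open>Near a point with nonzero \<open>J\<close> the sign is constant, so \<open>Psi\<close>
  and \<open>Phi\<close> differ locally by a constant.\<close>

lemma Psi_has_derivative:
  assumes rt: "root_triple (j t) (e t) a b c" and J: "j t \<noteq> 0"
    and dj: "(j has_real_derivative j') (at t)" and de: "(e has_real_derivative e') (at t)"
  shows "((\<lambda>\<tau>. Psi (j \<tau>) (e \<tau>)) has_real_derivative
    4 * sqrt 2 * j t * e' * moment_sum a b c 1 1 1
      + 2 * sqrt 2 * j' * moment_sum a b c (b * c) (c * a) (a * b)) (at t)"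
proof -
  have a: "0 < a"
    using rt J root_triple_sign(2)[OF rt] by (auto simp: root_triple_def less_le)
  have lim: "(j \<longlongrightarrow> j t) (nhds t)" "(e \<longlongrightarrow> e t) (nhds t)"
    using DERIV_isCont[OF dj] DERIV_isCont[OF de] by (auto simp: isCont_def tendsto_at_iff_tendsto_nhds)
  have "\<forall>\<^sub>F \<tau> in nhds t. sgn (j \<tau>) = sgn (j t)"
  proof (cases "0 < j t")
    case True
    then show ?thesis
      using order_tendstoD(1)[OF lim(1) True] by (auto elim!: eventually_mono)
  next
    case False
    then have neg: "j t < 0"
      using J by simp
    then show ?thesis
      using order_tendstoD(2)[OF lim(1) neg] by (auto elim!: eventually_mono)
  qed
  then have "\<forall>\<^sub>F \<tau> in nhds t. Phi (j \<tau>) (e \<tau>) - pi * sgn (j t) = Psi (j \<tau>) (e \<tau>)"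
    using root_triple_eventually[OF rt lim]
  proof eventually_elim
    case (elim \<tau>)
    then have "j \<tau> \<noteq> 0"
      using J by (metis sgn_0_0)
    then show ?case
      using Psi_eq_Phi[OF elim(2)] elim(1) by simp
  qed
  moreover have "((\<lambda>\<tau>. Phi (j \<tau>) (e \<tau>) - pi * sgn (j t)) has_real_derivative
    4 * sqrt 2 * j t * e' * moment_sum a b c 1 1 1
      + 2 * sqrt 2 * j' * moment_sum a b c (b * c) (c * a) (a * b) - 0) (at t)"
    by (intro DERIV_diff Phi_has_derivative rt a dj de DERIV_const)
  ultimately show ?thesis
    by (subst (asm) DERIV_cong_ev[OF refl _ refl]) auto
qed

text \<open>The two integrands differ, up to sign, by the derivative of \<open>sin * cos / (w * \<sigma> + w\<^sup>2 * sqrt \<sigma>)\<close>.\<close>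

lemma renormalized_integral_eq_cos_moment:
  assumes pos: "0 < b" "c < 0"
  shows "integral {0..pi / 2} (\<lambda>x. renormalized_integrand (0 * (cos x)\<^sup>2 + b * (sin x)\<^sup>2, c))
    = cos_moment 0 b c"
proof -
  define w where "w = sqrt (- c)"
  define R where "R x = sqrt (b * (sin x)\<^sup>2 - c)" for x
  have w: "0 < w" "w\<^sup>2 = - c"
    using pos by (auto simp: w_def)
  have \<sigma>: "0 < b * (sin x)\<^sup>2 - c" for x
    using cos_sin_diff_pos[of c 0 b x] pos by simp
  have R: "0 < R x" "(R x)\<^sup>2 = b * (sin x)\<^sup>2 - c" for x
    using \<sigma>[of x] by (auto simp: R_def)
  \<comment> \<open>This is \<open>w\<close> times the function named above; the factor is divided
    out after integrating.\<close>
  have "((\<lambda>x. sin x * cos x / ((R x)\<^sup>2 + w * R x)) has_real_derivative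
      (cos x)\<^sup>2 * w / (R x) ^ 3 - 1 / (R x * (R x + w))) (at x)" for x
  proof -
    let ?R' = "b * (sin x * cos x) / R x" and ?q = "(R x)\<^sup>2 + w * R x"
    have "(R has_real_derivative ?R') (at x)"
      unfolding R_def using \<sigma>[of x]
      by (auto intro!: derivative_eq_intros simp: divide_simps)
    then have "((\<lambda>x. (R x)\<^sup>2 + w * R x) has_real_derivative 2 * R x * ?R' + w * ?R') (at x)"
      by (auto intro!: derivative_eq_intros)
    moreover have "((\<lambda>x. sin x * cos x) has_real_derivative (cos x)\<^sup>2 - (sin x)\<^sup>2) (at x)"
      by (auto intro!: derivative_eq_intros simp: power2_eq_square)
    moreover have q: "?q \<noteq> 0"
      using R w by (smt (verit) mult_pos_pos zero_less_power)
    ultimately have D: "((\<lambda>x. sin x * cos x / ((R x)\<^sup>2 + w * R x)) has_real_derivative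
        (((cos x)\<^sup>2 - (sin x)\<^sup>2) * ?q - sin x * cos x * (2 * R x * ?R' + w * ?R')) / (?q * ?q)) (at x)"
      by (intro DERIV_divide)
    have cs: "(cos x)\<^sup>2 + (sin x)\<^sup>2 = 1" and R2: "(R x)\<^sup>2 = b * (sin x)\<^sup>2 + w\<^sup>2" and RR: "R x * ?R' = b * (sin x * cos x)"
      using R[of x] w by auto
    have qR: "?q = R x * (R x + w)"
      by (simp add: power2_eq_square distrib_left)
    have "R x * (((cos x)\<^sup>2 - (sin x)\<^sup>2) * ?q - sin x * cos x * (2 * R x * ?R' + w * ?R'))
        = (cos x)\<^sup>2 * w * (R x + w)\<^sup>2 - (R x)\<^sup>2 * (R x + w)"
      using cs R2 RR by algebra
    also have "\<dots> = R x * (((cos x)\<^sup>2 * w / (R x) ^ 3 - 1 / (R x * (R x + w))) * (?q * ?q))"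
    proof -
      have "C * w * u\<^sup>2 - r\<^sup>2 * u = r * ((C * w / r ^ 3 - 1 / (r * u)) * (r * u * (r * u)))"
        if "0 < r" "0 < u" for C r u :: real
        using that by (simp add: field_simps power2_eq_square power3_eq_cube)
      from this[of "R x" "R x + w" "(cos x)\<^sup>2"] R(1)[of x] w(1) show ?thesis
        unfolding qR by simp
    qed
    finally have "((cos x)\<^sup>2 - (sin x)\<^sup>2) * ?q - sin x * cos x * (2 * R x * ?R' + w * ?R')
        = ((cos x)\<^sup>2 * w / (R x) ^ 3 - 1 / (R x * (R x + w))) * (?q * ?q)"
      using R(1)[of x] by (simp only: mult_cancel_left) simp
    then show ?thesis
      using q by (intro DERIV_cong[OF D]) simp
  qed
  then have "((\<lambda>x. (cos x)\<^sup>2 * w / (R x) ^ 3 - 1 / (R x * (R x + w))) has_integral 0) {0..pi / 2}"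
    using has_integral_of_derivative[of 0 "pi / 2" "\<lambda>x. sin x * cos x / ((R x)\<^sup>2 + w * R x)"] by simp
  from has_integral_divide[OF this, of w]
  have "((\<lambda>x. ((cos x)\<^sup>2 * w / (R x) ^ 3 - 1 / (R x * (R x + w))) / w) has_integral 0) {0..pi / 2}"
    by simp
  moreover have "((\<lambda>x. (cos x)\<^sup>2 / ((R x)\<^sup>2 * R x)) has_integral cos_moment 0 b c) {0..pi / 2}"
    using cos_moment_has_integral[of c 0 b] pos unfolding R(2) by (simp add: R_def)
  ultimately have "((\<lambda>x. (cos x)\<^sup>2 / ((R x)\<^sup>2 * R x) -
      ((cos x)\<^sup>2 * w / (R x) ^ 3 - 1 / (R x * (R x + w))) / w) has_integral cos_moment 0 b c - 0) {0..pi / 2}"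
    by (intro has_integral_diff)
  moreover have "(cos x)\<^sup>2 / ((R x)\<^sup>2 * R x) - ((cos x)\<^sup>2 * w / (R x) ^ 3 - 1 / (R x * (R x + w))) / w
      = renormalized_integrand (0 * (cos x)\<^sup>2 + b * (sin x)\<^sup>2, c)" for x
  proof -
    have "renormalized_integrand (0 * (cos x)\<^sup>2 + b * (sin x)\<^sup>2, c) = 1 / (w * R x * (w + R x))"
      by (simp add: renormalized_integrand_def R_def w_def)
    then show ?thesis
      using w(1) R(1)[of x] by (simp add: diff_divide_distrib power2_eq_square power3_eq_cube ac_simps)
  qed
  ultimately show ?thesis
    by (intro integral_unique) simp
qed

text \<open>Since \<open>Psi 0 E = 0\<close>, the difference quotient is - 2 sqrt 2 times the
  renormalized integral, and its limit is that integral at a = 0. The integral is known to be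
  \<open>cos_moment 0 b c\<close>, and \<open>moment_sum\<close> reduces to minus the same
  moment.\<close>

lemma Psi_has_derivative_Gamma_plus:
  assumes rt: "root_triple 0 E 0 b c"
  shows "((\<lambda>j. Psi j E) has_real_derivative 2 * sqrt 2 * moment_sum 0 b c (b * c) (c * 0) (0 * b)) (at 0)"
proof -
  have bc: "0 < b" "c < 0"
    using root_triple_less[OF rt] by auto
  have lim: "((\<lambda>j. j) \<longlongrightarrow> 0) (at (0::real))" "((\<lambda>_. E) \<longlongrightarrow> E) (at (0::real))"
    by (auto intro: tendsto_ident_at)
  have "((\<lambda>j. integral {0..pi / 2} (\<lambda>x. renormalized_integrand
      (y1 j E * (cos x)\<^sup>2 + y2 j E * (sin x)\<^sup>2, y3 j E))) \<longlongrightarrow> cos_moment 0 b c) (at 0)"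
    unfolding renormalized_integral_eq_cos_moment[OF bc, symmetric]
    using bc
    by (intro cos_sin_integral_tendsto[OF convex_open_renormalized_domain continuous_renormalized_integrand]
        tendsto_roots[OF rt lim]) auto
  from tendsto_mult_left[OF this, of "- (2 * sqrt 2)"]
  have "((\<lambda>j. Psi j E / j) \<longlongrightarrow> - (2 * sqrt 2) * cos_moment 0 b c) (at 0)"
    by (rule Lim_transform_eventually)
      (simp add: eventually_at_filter Psi_eq_renormalized)
  moreover have "moment_sum 0 b c (b * c) (c * 0) (0 * b) = - cos_moment 0 b c"
    using bc by (simp add: moment_sum_def)
  moreover have "Psi 0 E = 0"
    by (simp add: Psi_def)
  ultimately show ?thesis
    by (simp add: has_field_derivative_iff)
qed

section \<open>The determinant\<close>

lemma moment_det_pos: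
  assumes rt: "root_triple J E a b c"
  shows "0 < moment_sum a b c a b c * moment_sum a b c (b * c) (c * a) (a * b)
    + 2 * J\<^sup>2 * (moment_sum a b c 1 1 1)\<^sup>2"
proof -
  note lt = root_triple_less[OF rt] and sign = root_triple_sign[OF rt]
  define X Y where "X = cos_moment a b c" and "Y = sin_moment a b c"
  have XY: "0 < Y" "Y < X"
    using lt sin_moment_pos sin_moment_less_cos_moment by (auto simp: X_def Y_def)
  obtain D where D: "(a - b) * (a - c) * (b - c) * D = 1" and
    inv: "inverse ((a - b) * (a - c)) = (b - c) * D" "inverse ((b - a) * (b - c)) = - (a - c) * D"
      "inverse ((c - a) * (c - b)) = (a - b) * D"
    using vandermonde_inverse lt by blast
  have sum: "moment_sum a b c u v w = - (u * X) * ((b - c) * D) - v * Y * (- (a - c) * D)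
      + w * (X + Y) * ((a - b) * D)" for u v w
    unfolding moment_sum_def divide_inverse inv X_def Y_def ..
  define S0 S1 S2 where "S0 = moment_sum a b c 1 1 1" and "S1 = moment_sum a b c a b c" and
    "S2 = moment_sum a b c (b * c) (c * a) (a * b)"
  \<comment> \<open>Subtracting a S0 turns the weights into (0, b - a, c - a): one term drops and
    each remaining one loses a denominator factor, which leaves b - c alone. The other two work
    likewise.\<close>
  define na nb nc where "na = S1 - a * S0" and "nb = S1 - b * S0" and "nc = S1 - c * S0"
  have "(b - c) * na = - (X + 2 * Y)" "(a - c) * nb = - (2 * X + Y)" "(b - a) * nc = X - Y"
    using D unfolding na_def nb_def nc_def S0_def S1_def sum by algebra+
  then have "(b - c) * na < 0" "(a - c) * nb < 0" "0 < (b - a) * nc"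
    using XY by simp_all
  then have n: "na < 0" "nb < 0" "0 < nc"
    using lt by (auto simp: mult_less_0_iff zero_less_mult_iff)
  have J: "2 * J\<^sup>2 = - (a * b * c)"
    using rt by (simp add: root_triple_def)
  \<comment> \<open>S0, S1, S2 are combinations of X and Y only, hence linearly dependent.
    Eliminating S2 leaves a quadratic form in S0 and S1, which is rewritten through the products of
    na, nb, nc.\<close>
  have "3 * S2 = 2 * (a * b + b * c + c * a) * S0 - (a + b + c) * S1"
    unfolding S0_def S1_def S2_def sum by algebra
  then have "3 * (S1 * S2 - a * b * c * S0\<^sup>2) = - (a * nb * nc + b * na * nc + c * na * nb)"
    unfolding na_def nb_def nc_def by algebra
  moreover have "0 < a * (- nb * nc) + b * (- na * nc) + - c * (na * nb)"
  proof (rule add_pos_nonneg[OF add_nonneg_pos])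
    show "0 \<le> a * (- nb * nc)"
      using n sign by (intro mult_nonneg_nonneg) auto
    show "0 < b * (- na * nc)"
      using n sign by (intro mult_pos_pos) auto
    show "0 \<le> - c * (na * nb)"
      using n sign by (intro mult_nonneg_nonneg mult_nonpos_nonpos) auto
  qed
  ultimately have "0 < S1 * S2 - a * b * c * S0\<^sup>2"
    by simp
  then show ?thesis
    unfolding J S0_def S1_def S2_def by simp
qed

section \<open>Both determinants on the whole domain\<close>

lemma jacobian_det_eq:
  assumes "((\<lambda>e. F J e) has_real_derivative a) (at E)" "((\<lambda>e. G J e) has_real_derivative b) (at E)"
    "((\<lambda>j. F j E) has_real_derivative c) (at J)" "((\<lambda>j. G j E) has_real_derivative d) (at J)"
  shows "jacobian_det F G J E = a * d - b * c" "partials_exist F J E" "partials_exist G J E"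
  using assms[THEN DERIV_imp_deriv] assms
  by (auto simp: jacobian_det_def det_2 partials_exist_def real_differentiable_def)

theorem proposition4p5:
  fixes J E :: real
  assumes "(J, E) \<in> Dom"
  shows "Delta J E > 0 \<and>
    ((J, E) \<notin> Gamma_plus \<longrightarrow>
       partials_exist T J E \<and> partials_exist Phi J E \<and> Delta J E = jacobian_det T Phi J E) \<and>
    ((J, E) \<notin> Gamma_minus \<longrightarrow>
       partials_exist T J E \<and> partials_exist Psi J E \<and> Delta J E = jacobian_det T Psi J E)"
proof -
  obtain a b c where rt: "root_triple J E a b c"
    using Dom_root_triple[OF assms] .
  note lt = root_triple_less[OF rt] and sign = root_triple_sign[OF rt]
  let ?S0 = "moment_sum a b c 1 1 1" and ?S1 = "moment_sum a b c a b c"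
    and ?S2 = "moment_sum a b c (b * c) (c * a) (a * b)"
  have T: "((\<lambda>e. T J e) has_real_derivative 4 * sqrt 2 * ?S1) (at E)"
    "((\<lambda>j. T j E) has_real_derivative - (4 * sqrt 2 * J * ?S0)) (at J)"
    using T_has_derivative[of "\<lambda>_. J" E "\<lambda>e. e" a b c 0 1] T_has_derivative[of "\<lambda>j. j" J "\<lambda>_. E" a b c 1 0] rt
    by (auto simp: mult.assoc)
  \<comment> \<open>The off-diagonal entries are opposite, so their product enters the determinant
    as a square with a plus sign.\<close>
  have det: "4 * sqrt 2 * ?S1 * (2 * sqrt 2 * ?S2) - 4 * sqrt 2 * J * ?S0 * - (4 * sqrt 2 * J * ?S0)
      = 16 * (?S1 * ?S2 + 2 * J\<^sup>2 * ?S0\<^sup>2)"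
  proof -
    have "4 * k * p * (2 * k * q) - 4 * k * J * r * - (4 * k * J * r) = k\<^sup>2 * (8 * (p * q + 2 * J\<^sup>2 * r\<^sup>2))"
      for k p q r :: real
      by (simp add: algebra_simps power2_eq_square)
    from this[of "sqrt 2"] show ?thesis
      by simp
  qed
  \<comment> \<open>Stated for any \<open>G\<close> with these two partial derivatives: it applies
    to \<open>Phi\<close> and \<open>Psi\<close> alike and shows that the two determinants agree
    where both are used.\<close>
  have main: "0 < jacobian_det T G J E" "partials_exist T J E" "partials_exist G J E"
    "jacobian_det T G J E = 16 * (?S1 * ?S2 + 2 * J\<^sup>2 * ?S0\<^sup>2)"
    if "((\<lambda>e. G J e) has_real_derivative 4 * sqrt 2 * J * ?S0) (at E)"
      "((\<lambda>j. G j E) has_real_derivative 2 * sqrt 2 * ?S2) (at J)" for G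
    using jacobian_det_eq[OF T(1) that(1) T(2) that(2)] moment_det_pos[OF rt] unfolding det by auto
  \<comment> \<open>Translates membership in \<open>Gamma_plus\<close> and
    \<open>Gamma_minus\<close> into the vanishing of the root a or c.\<close>
  have J0: "a = 0 \<and> 0 < E \<or> c = 0 \<and> -1 / 4 < E \<and> E < 0" if "J = 0"
  proof -
    have "a = 0 \<or> c = 0"
      using rt sign that by (auto simp: root_triple_def)
    then show ?thesis
    proof
      assume "a = 0"
      moreover from this have "b * c < 0"
        using lt by (simp add: mult_pos_neg)
      ultimately show ?thesis
        using rt by (simp add: root_triple_def)
    next
      assume c: "c = 0"
      then have ab: "a + b = 2" "a * b = - 4 * E"
        using rt by (auto simp: root_triple_def)
      have "0 < a * b"
        using lt c by simp
      \<comment> \<open>The discriminant of the remaining quadratic gives the bound - 1 / 4 <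
        E.\<close>
      moreover have "0 < (a - b)\<^sup>2"
        using lt by simp
      moreover have "(a - b)\<^sup>2 = (a + b)\<^sup>2 - 4 * (a * b)"
        by (simp add: power2_eq_square algebra_simps)
      ultimately show ?thesis
        using c unfolding ab by simp
    qed
  qed
  have Phi: "((\<lambda>e. Phi J e) has_real_derivative 4 * sqrt 2 * J * ?S0) (at E)"
    "((\<lambda>j. Phi j E) has_real_derivative 2 * sqrt 2 * ?S2) (at J)" if "(J, E) \<notin> Gamma_plus"
  proof -
    have "0 < a"
      using that J0 rt sign by (cases "J = 0") (auto simp: Gamma_plus_def root_triple_def less_le)
    then show "((\<lambda>e. Phi J e) has_real_derivative 4 * sqrt 2 * J * ?S0) (at E)"
      "((\<lambda>j. Phi j E) has_real_derivative 2 * sqrt 2 * ?S2) (at J)"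
      using Phi_has_derivative[of "\<lambda>_. J" E "\<lambda>e. e" a b c 0 1]
        Phi_has_derivative[of "\<lambda>j. j" J "\<lambda>_. E" a b c 1 0] rt by auto
  qed
  have Psi: "((\<lambda>e. Psi J e) has_real_derivative 4 * sqrt 2 * J * ?S0) (at E)"
    "((\<lambda>j. Psi j E) has_real_derivative 2 * sqrt 2 * ?S2) (at J)" if "(J, E) \<notin> Gamma_minus"
  proof -
    \<comment> \<open>For \<open>J = 0\<close> the function \<open>Psi\<close> vanishes identically
      in e, and so does the claimed derivative.\<close>
    show "((\<lambda>e. Psi J e) has_real_derivative 4 * sqrt 2 * J * ?S0) (at E)"
      using Psi_has_derivative[of "\<lambda>_. J" E "\<lambda>e. e" a b c 0 1] rt
      by (cases "J = 0") (auto simp: Psi_def)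
    show "((\<lambda>j. Psi j E) has_real_derivative 2 * sqrt 2 * ?S2) (at J)"
    proof (cases "J = 0")
      case True
      then have "a = 0"
        using J0 that by (auto simp: Gamma_minus_def)
      then show ?thesis
        using Psi_has_derivative_Gamma_plus True rt by simp
    next
      case False
      then show ?thesis
        using Psi_has_derivative[of "\<lambda>j. j" J "\<lambda>_. E" a b c 1 0] rt by auto
    qed
  qed
  show ?thesis
  proof (cases "(J, E) \<in> Gamma_plus")
    case True
    then have "(J, E) \<notin> Gamma_minus"
      by (auto simp: Gamma_plus_def Gamma_minus_def)
    then show ?thesis
      using main[OF Psi] True by (simp add: Delta_def)
  next
    case False
    then show ?thesis
      using main[OF Phi] main[OF Psi] by (auto simp: Delta_def)
  qed
qed

end
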